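(* Let $\mathcal H$ be a complex Hilbert space with $\dim\mathcal H\ge3$ and let $0\ne T\in\mathcal B(\mathcal H)$. Then the subspace $\mathbb CT$ has complete hyperreflexivity constant one, i.e. $\kappa^c_{\mathbb CT}=1$, if and only if $\operatorname{rank}T=1$.
   Context: For a linear subspace $\mathcal S\subset\mathcal B(\mathcal H)$ and $x\in\mathcal H$, $P_{\mathcal Sx}$ is the orthogonal projection onto $\overline{\mathcal Sx}$, and $\beta_{\mathcal S}(T)=\sup_{\|x\|=1}\|P_{\mathcal Sx}^\perp Tx\|$. $\mathcal S$ is hyperreflexive if there is a constant $C$ with $\operatorname{dist}(T,\mathcal S)\le C\,\beta_{\mathcal S}(T)$ for all $T\in\mathcal B(\mathcal H)$; $\kappa_{\mathcal S}$ denotes the least such constant $C\ge1$. For a WOT-closed subspace $\mathcal S$, $\kappa^c_{\mathcal S}$ is the hyperreflexivity constant of $\mathcal S\,\bar\otimes\,\mathcal B(\mathcal K)\subset\mathcal B(\mathcal H\otimes\mathcal K)$ (the WOT-closure of the spatial tensor product), where $\mathcal K$ is a separable infinite-dimensional Hilbert space. *)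

theory Defs
  imports "HOL-Analysis.Analysis"
begin

section \<open>Complex Hilbert spaces\<close>

class complex_vector = real_vector +
  fixes scaleC :: "complex \<Rightarrow> 'a \<Rightarrow> 'a"  (infixr \<open>*\<^sub>C\<close> 75)
  assumes scaleC_of_real: "complex_of_real r *\<^sub>C x = r *\<^sub>R x"
    and scaleC_add_right: "a *\<^sub>C (x + y) = a *\<^sub>C x + a *\<^sub>C y"
    and scaleC_add_left: "(a + b) *\<^sub>C x = a *\<^sub>C x + b *\<^sub>C x"
    and scaleC_scaleC: "a *\<^sub>C (b *\<^sub>C x) = (a * b) *\<^sub>C x"

lemma vector_space_scaleC:
  "vector_space (scaleC :: complex \<Rightarrow> 'a \<Rightarrow> 'a::complex_vector)"
proof
  show "1 *\<^sub>C x = x" for x :: 'a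
    using scaleC_of_real[of 1 x] by simp
qed (simp_all add: scaleC_add_right scaleC_add_left scaleC_scaleC)

global_interpretation complex_vector: vector_space
  "scaleC :: complex \<Rightarrow> 'a \<Rightarrow> 'a::complex_vector"
  defines cspan = complex_vector.span
    and cdim_nat = complex_vector.dim
  by (rule vector_space_scaleC)

abbreviation clinear :: "('a::complex_vector \<Rightarrow> 'b::complex_vector) \<Rightarrow> bool"
  where "clinear \<equiv> Vector_Spaces.linear (*\<^sub>C) (*\<^sub>C)"

text \<open>The library's \<open>dim\<close> is a natural number and is not meaningful for
  infinite-dimensional spaces, hence the extended value.\<close>

definition cdim :: "'a::complex_vector set \<Rightarrow> enat"
  where "cdim V = (if \<exists>B. finite B \<and> V \<subseteq> cspan B then enat (cdim_nat V) else \<infinity>)"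

text \<open>The inner product is linear in the first argument.\<close>

class chilbert_space = complex_vector + banach +
  fixes cinner :: "'a \<Rightarrow> 'a \<Rightarrow> complex"
  assumes cinner_commute: "cinner x y = cnj (cinner y x)"
    and cinner_add_left: "cinner (x + y) z = cinner x z + cinner y z"
    and cinner_scaleC_left: "cinner (a *\<^sub>C x) y = a * cinner x y"
    and cinner_self: "cinner x x = complex_of_real ((norm x)\<^sup>2)"

instantiation complex :: chilbert_space
begin

definition scaleC_complex :: "complex \<Rightarrow> complex \<Rightarrow> complex"
  where "scaleC_complex a x = a * x"

definition cinner_complex :: "complex \<Rightarrow> complex \<Rightarrow> complex"
  where "cinner_complex x y = x * cnj y"

instance
  by standard
    (simp_all add: scaleC_complex_def cinner_complex_def algebra_simps
      scaleR_conv_of_real complex_norm_square del: of_real_power)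

end

lemma norm_scaleC: "norm (a *\<^sub>C x) = cmod a * norm (x :: 'a::chilbert_space)"
proof -
  have "cinner (a *\<^sub>C x) (a *\<^sub>C x) = a * cnj (cinner (a *\<^sub>C x) x)"
    by (metis cinner_commute cinner_scaleC_left)
  also have "\<dots> = (a * cnj a) * complex_of_real ((norm x)\<^sup>2)"
    by (simp add: cinner_scaleC_left cinner_self)
  also have "\<dots> = complex_of_real ((cmod a * norm x)\<^sup>2)"
    by (simp add: complex_norm_square[symmetric] power_mult_distrib)
  finally have "(norm (a *\<^sub>C x))\<^sup>2 = (cmod a * norm x)\<^sup>2"
    unfolding cinner_self of_real_eq_iff .
  then show ?thesis
    by (simp add: power2_eq_iff_nonneg)
qed

lemma bounded_linear_scaleC: "bounded_linear (\<lambda>x :: 'a::chilbert_space. a *\<^sub>C x)"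
proof (rule bounded_linear_intro[where K = "cmod a"])
  show "a *\<^sub>C r *\<^sub>R x = r *\<^sub>R a *\<^sub>C x" for r :: real and x :: 'a
    by (simp add: scaleC_of_real[symmetric] scaleC_scaleC mult.commute)
qed (simp_all add: scaleC_add_right norm_scaleC mult.commute)

instantiation blinfun :: (real_normed_vector, chilbert_space) complex_vector
begin

lift_definition scaleC_blinfun :: "complex \<Rightarrow> 'a \<Rightarrow>\<^sub>L 'b \<Rightarrow> 'a \<Rightarrow>\<^sub>L 'b"
  is "\<lambda>a f x. a *\<^sub>C f x"
  by (rule bounded_linear_compose[OF bounded_linear_scaleC])

instance
  by standard
    (transfer; simp add: scaleC_of_real scaleC_add_right scaleC_add_left scaleC_scaleC)+

end


section \<open>Bounded operators\<close>

text \<open>Elements of \<open>'a \<Rightarrow>\<^sub>L 'b\<close> are only real-linear. On the complex-linear ones,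
  the norm of that type is the usual operator norm.\<close>

definition bounded_ops :: "('a::chilbert_space \<Rightarrow>\<^sub>L 'a) set"
  where "bounded_ops = {A. clinear (blinfun_apply A)}"

definition crank :: "('a::chilbert_space \<Rightarrow>\<^sub>L 'a) \<Rightarrow> enat"
  where "crank A = cdim (range (blinfun_apply A))"

definition wot :: "('a::chilbert_space \<Rightarrow>\<^sub>L 'a) topology"
  where "wot = topology_generated_by
    {{A \<in> bounded_ops. cinner (blinfun_apply A x) y \<in> U} | x y U. open U}"

definition orth_proj :: "'a::chilbert_space set \<Rightarrow> 'a \<Rightarrow> 'a"
  where "orth_proj M y = (THE p. p \<in> M \<and> (\<forall>m\<in>M. cinner (y - p) m = 0))"


section \<open>Hyperreflexivity\<close>

definition beta :: "('a::chilbert_space \<Rightarrow>\<^sub>L 'a) set \<Rightarrow> ('a \<Rightarrow>\<^sub>L 'a) \<Rightarrow> real"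
  where "beta S A = (SUP x\<in>{x. norm x = 1}.
    norm (blinfun_apply A x
      - orth_proj (closure ((\<lambda>B. blinfun_apply B x) ` S)) (blinfun_apply A x)))"

definition hyperreflexive_with :: "real \<Rightarrow> ('a::chilbert_space \<Rightarrow>\<^sub>L 'a) set \<Rightarrow> bool"
  where "hyperreflexive_with C S \<longleftrightarrow> (\<forall>A\<in>bounded_ops. infdist A S \<le> C * beta S A)"

text \<open>The value is \<open>\<infinity>\<close> exactly when \<open>S\<close> is not hyperreflexive; otherwise the infimum
  is attained.\<close>

definition kappa :: "('a::chilbert_space \<Rightarrow>\<^sub>L 'a) set \<Rightarrow> ereal"
  where "kappa S = Inf {ereal C | C. C \<ge> 1 \<and> hyperreflexive_with C S}"


section \<open>Tensor products\<close>

text \<open>\<open>t\<close> exhibits \<open>'l\<close> as the Hilbert space tensor product of \<open>'h\<close> and \<open>'k\<close>, which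
  determines \<open>'l\<close> up to a unitary compatible with \<open>t\<close>.\<close>

definition hilbert_tensor ::
    "('h::chilbert_space \<Rightarrow> 'k::chilbert_space \<Rightarrow> 'l::chilbert_space) \<Rightarrow> bool"
  where "hilbert_tensor t \<longleftrightarrow>
    (\<forall>y. clinear (\<lambda>x. t x y)) \<and> (\<forall>x. clinear (t x)) \<and>
    (\<forall>x y x' y'. cinner (t x y) (t x' y') = cinner x x' * cinner y y') \<and>
    closure (cspan {t x y | x y. True}) = UNIV"

definition tensor_op ::
    "('h::chilbert_space \<Rightarrow> 'k::chilbert_space \<Rightarrow> 'l::chilbert_space) \<Rightarrow>
      ('h \<Rightarrow>\<^sub>L 'h) \<Rightarrow> ('k \<Rightarrow>\<^sub>L 'k) \<Rightarrow> ('l \<Rightarrow>\<^sub>L 'l)"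
  where "tensor_op t A B = (THE D. D \<in> bounded_ops \<and>
    (\<forall>x y. blinfun_apply D (t x y) = t (blinfun_apply A x) (blinfun_apply B y)))"

definition spatial_tensor ::
    "('h::chilbert_space \<Rightarrow> 'k::chilbert_space \<Rightarrow> 'l::chilbert_space) \<Rightarrow>
      ('h \<Rightarrow>\<^sub>L 'h) set \<Rightarrow> ('k \<Rightarrow>\<^sub>L 'k) set \<Rightarrow> ('l \<Rightarrow>\<^sub>L 'l) set"
  where "spatial_tensor t S R = closure (cspan {tensor_op t A B | A B. A \<in> S \<and> B \<in> R})"

definition wot_tensor ::
    "('h::chilbert_space \<Rightarrow> 'k::chilbert_space \<Rightarrow> 'l::chilbert_space) \<Rightarrow>
      ('h \<Rightarrow>\<^sub>L 'h) set \<Rightarrow> ('k \<Rightarrow>\<^sub>L 'k) set \<Rightarrow> ('l \<Rightarrow>\<^sub>L 'l) set"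
  where "wot_tensor t S R = wot closure_of (spatial_tensor t S R)"

definition kappa_c ::
    "('h::chilbert_space \<Rightarrow> 'k::chilbert_space \<Rightarrow> 'l::chilbert_space) \<Rightarrow>
      ('h \<Rightarrow>\<^sub>L 'h) set \<Rightarrow> ereal"
  where "kappa_c t S = kappa (wot_tensor t S bounded_ops)"

end

theory Submission
  imports Defs
begin

text \<open>
  The weakly closed space in question is \<open>S = {T \<otimes> B}\<close>. If \<open>T\<close> has rank one, then \<open>S\<close> is a full
  corner \<open>P B(H \<otimes> K) Q\<close>, \<open>\<beta>\<^sub>S(A)\<close> is the larger of the norms of \<open>(1 - P) A\<close> and
  \<open>A (1 - Q)\<close>, and Parrott's theorem identifies it with the distance from \<open>A\<close> to \<open>S\<close>.

  If the rank is at least two, choose orthonormal \<open>h1\<close>, \<open>h2\<close> and \<open>k1\<close>, \<open>k2\<close> with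
  \<open>T h1 = \<alpha> k1\<close>, \<open>T h2 = \<beta> k1 + \<gamma> k2\<close> and \<open>\<alpha>, \<gamma> > 0\<close>, and orthonormal \<open>f1\<close>, \<open>f2\<close> in \<open>K\<close>. Let
  \<open>A\<close> map \<open>h1 \<otimes> f1\<close> to \<open>y1 = (k1 \<otimes> f1 + k2 \<otimes> f2) / \<surd>2\<close> and \<open>h2 \<otimes> f1\<close> to
  \<open>y2 = - k2 \<otimes> f1\<close>, and vanish on the orthogonal complement of these two vectors. The functional
  \<open>D \<mapsto> \<gamma> \<surd>2 \<langle>D (h1 \<otimes> f1), y1\<rangle> + \<alpha> \<langle>D (h2 \<otimes> f1), y2\<rangle>\<close> annihilates \<open>S\<close> and attains its norm
  at \<open>A\<close>, so \<open>A\<close> has distance one to \<open>S\<close>. But no unit vector \<open>x = (a h1 + b h2) \<otimes> f1\<close> satisfies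
  \<open>A x \<bottom> S x\<close>, and compactness of the set of pairs \<open>(a, b)\<close> gives \<open>\<beta>\<^sub>S(A) < 1\<close>.
\<close>

section \<open>Bounded operators on complex Hilbert spaces\<close>

lemma cinner_add_right: "cinner x (y + z) = cinner x y + cinner x (z :: 'a::chilbert_space)"
  by (metis cinner_add_left cinner_commute complex_cnj_add)

lemma cinner_scaleC_right: "cinner x (a *\<^sub>C y) = cnj a * cinner x (y :: 'a::chilbert_space)"
  by (metis cinner_commute cinner_scaleC_left complex_cnj_mult)

lemma cinner_zero_left [simp]: "cinner 0 (y :: 'a::chilbert_space) = 0"
  using cinner_add_left[of 0 0 y] by simp

lemma cinner_zero_right [simp]: "cinner (y :: 'a::chilbert_space) 0 = 0"
  using cinner_add_right[of y 0 0] by simp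

lemma cinner_minus_left: "cinner (- x) y = - cinner x (y :: 'a::chilbert_space)"
  using cinner_add_left[of x "- x" y] by (simp add: minus_unique)

lemma cinner_minus_right: "cinner x (- y) = - cinner x (y :: 'a::chilbert_space)"
  using cinner_add_right[of x y "- y"] by (simp add: minus_unique)

lemma cinner_diff_left: "cinner (x - y) z = cinner x z - cinner y (z :: 'a::chilbert_space)"
  using cinner_add_left[of x "- y" z] by (simp add: cinner_minus_left)

lemma cinner_diff_right: "cinner x (y - z) = cinner x y - cinner x (z :: 'a::chilbert_space)"
  using cinner_add_right[of x y "- z"] by (simp add: cinner_minus_right)

lemmas cinner_simps = cinner_add_left cinner_add_right cinner_diff_left cinner_diff_right
  cinner_minus_left cinner_minus_right cinner_scaleC_left cinner_scaleC_right

lemma cinner_sum_left: "cinner (sum f I) y = (\<Sum>i\<in>I. cinner (f i) (y :: 'a::chilbert_space))"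
  by (induction I rule: infinite_finite_induct) (simp_all add: cinner_add_left)

lemma cinner_sum_right: "cinner y (sum f I) = (\<Sum>i\<in>I. cinner (y :: 'a::chilbert_space) (f i))"
  by (induction I rule: infinite_finite_induct) (simp_all add: cinner_add_right)

lemma Re_cinner_self: "Re (cinner x x) = (norm (x :: 'a::chilbert_space))\<^sup>2"
  by (simp add: cinner_self)

lemma cinner_self_eq_0: "cinner x x = 0 \<longleftrightarrow> (x :: 'a::chilbert_space) = 0"
  by (simp add: cinner_self)

lemma Re_cinner_commute: "Re (cinner y x) = Re (cinner x (y :: 'a::chilbert_space))"
  by (subst cinner_commute) simp

lemma norm_add_sq:
  "(norm (x + y))\<^sup>2 = (norm x)\<^sup>2 + (norm y)\<^sup>2 + 2 * Re (cinner x (y :: 'a::chilbert_space))"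
  using Re_cinner_commute[of x y]
  by (simp add: Re_cinner_self[symmetric] cinner_simps)

lemma norm_diff_sq:
  "(norm (x - y))\<^sup>2 = (norm x)\<^sup>2 + (norm y)\<^sup>2 - 2 * Re (cinner x (y :: 'a::chilbert_space))"
  using Re_cinner_commute[of x y]
  by (simp add: Re_cinner_self[symmetric] cinner_simps)

text \<open>The scalar is \<open>\<langle>y, v\<rangle> / \<tau>\<^sup>2\<close>. For
  \<open>\<tau> = norm v\<close> it is the projection coefficient; a larger \<open>\<tau>\<close>
  gives a shorter step whose gain has a denominator independent of \<open>v\<close>, which later
  makes the estimate of \<open>beta\<close> uniform.\<close>

lemma exists_scaleC_reducing_norm:
  fixes y v :: "'a::chilbert_space"
  assumes "norm v \<le> \<tau>" and "0 < \<tau>"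
  shows "\<exists>c. (norm (y - c *\<^sub>C v))\<^sup>2 \<le> (norm y)\<^sup>2 - (cmod (cinner y v))\<^sup>2 / \<tau>\<^sup>2"
proof -
  define q where "q = cinner y v"
  define c where "c = q / complex_of_real (\<tau>\<^sup>2)"
  have "Re (cinner y (c *\<^sub>C v)) = Re (cnj c * q)"
    by (simp add: cinner_scaleC_right q_def)
  also have "cnj c * q = complex_of_real ((cmod q)\<^sup>2 / \<tau>\<^sup>2)"
    by (simp add: c_def complex_norm_square mult.commute del: of_real_power)
  finally have 1: "Re (cinner y (c *\<^sub>C v)) = (cmod q)\<^sup>2 / \<tau>\<^sup>2" by simp
  have "norm (c *\<^sub>C v) \<le> cmod q / \<tau>\<^sup>2 * \<tau>"
    unfolding norm_scaleC using assms
    by (intro mult_mono) (simp_all add: c_def norm_divide norm_power)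
  also have "\<dots> = cmod q / \<tau>" using assms by (simp add: power2_eq_square)
  finally have "(norm (c *\<^sub>C v))\<^sup>2 \<le> (cmod q)\<^sup>2 / \<tau>\<^sup>2"
    by (metis norm_ge_zero power_divide power_mono)
  then show ?thesis
    using 1 by (intro exI[of _ c]) (simp add: norm_diff_sq q_def)
qed

lemma cinner_Cauchy_Schwarz: "cmod (cinner x y) \<le> norm x * norm (y :: 'a::chilbert_space)"
proof (cases "y = 0")
  case False
  then obtain c where "(norm (x - c *\<^sub>C y))\<^sup>2 \<le> (norm x)\<^sup>2 - (cmod (cinner x y))\<^sup>2 / (norm y)\<^sup>2"
    using exists_scaleC_reducing_norm[of y "norm y" x] by auto
  then have "(cmod (cinner x y))\<^sup>2 / (norm y)\<^sup>2 \<le> (norm x)\<^sup>2"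
    using zero_le_power2[of "norm (x - c *\<^sub>C y)"] by linarith
  then have "(cmod (cinner x y))\<^sup>2 \<le> (norm x * norm y)\<^sup>2"
    using False by (simp add: field_simps power_mult_distrib)
  then show ?thesis
    by (simp add: power2_le_iff_abs_le)
qed simp

lemma cinner_ext:
  fixes u v :: "'a::chilbert_space"
  assumes "\<And>x. cinner x u = cinner x v"
  shows "u = v"
proof -
  have "cinner (u - v) (u - v) = 0"
    using assms by (simp add: cinner_diff_right)
  then show ?thesis by (simp add: cinner_self_eq_0)
qed

section \<open>Bounded complex-linear maps\<close>

lemma clinear_iff:
  "clinear f \<longleftrightarrow> (\<forall>x y. f (x + y) = f x + f y) \<and> (\<forall>c x. f (c *\<^sub>C x) = c *\<^sub>C f x)"
  by (simp add: Vector_Spaces.linear_iff vector_space_scaleC)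

text \<open>Stated for plain functions between possibly different spaces, so that slices, adjoints
  and compositions can be handled before \<open>Blinfun\<close> bundles them.\<close>

definition bounded_clinear :: "('a::chilbert_space \<Rightarrow> 'b::chilbert_space) \<Rightarrow> bool"
  where "bounded_clinear f \<longleftrightarrow> bounded_linear f \<and> (\<forall>c x. f (c *\<^sub>C x) = c *\<^sub>C f x)"

lemma bounded_clinearI:
  assumes add: "\<And>x y. f (x + y) = f x + f y" and scale: "\<And>c x. f (c *\<^sub>C x) = c *\<^sub>C f x"
    and bound: "\<And>x. norm (f x) \<le> C * norm x"
  shows "bounded_clinear f"
  unfolding bounded_clinear_def
proof (intro conjI allI)
  show "bounded_linear f"
  proof (rule bounded_linear_intro[where K = C])
    show "f (r *\<^sub>R x) = r *\<^sub>R f x" for r x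
      by (metis scale scaleC_of_real)
  qed (use add bound in \<open>simp_all add: mult.commute\<close>)
qed (rule scale)

lemma bounded_clinear_bounded_linear: "bounded_clinear f \<Longrightarrow> bounded_linear f"
  by (simp add: bounded_clinear_def)

lemma bounded_clinear_scaleC: "bounded_clinear f \<Longrightarrow> f (c *\<^sub>C x) = c *\<^sub>C f x"
  by (simp add: bounded_clinear_def)

lemma bounded_clinear_add: "bounded_clinear f \<Longrightarrow> f (x + y) = f x + f y"
  by (rule linear_add[OF bounded_linear.linear[OF bounded_clinear_bounded_linear]])

lemma bounded_clinear_diff: "bounded_clinear f \<Longrightarrow> f (x - y) = f x - f y"
  by (rule linear_diff[OF bounded_linear.linear[OF bounded_clinear_bounded_linear]])

lemma bounded_clinear_zero: "bounded_clinear f \<Longrightarrow> f 0 = 0"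
  by (rule linear_0[OF bounded_linear.linear[OF bounded_clinear_bounded_linear]])

lemma bounded_clinear_bound:
  assumes "bounded_clinear f"
  obtains C where "0 < C" "\<And>x. norm (f x) \<le> C * norm x"
  using bounded_linear.pos_bounded[OF bounded_clinear_bounded_linear[OF assms]]
  by (auto simp: mult.commute)

lemma continuous_on_bounded_clinear: "bounded_clinear f \<Longrightarrow> continuous_on s f"
  by (simp add: bounded_clinear_def linear_continuous_on)

lemma bounded_clinear_compose:
  "bounded_clinear f \<Longrightarrow> bounded_clinear g \<Longrightarrow> bounded_clinear (\<lambda>x. f (g x))"
  by (simp add: bounded_clinear_def bounded_linear_compose)

lemma bounded_clinear_ident: "bounded_clinear (\<lambda>x. x)"
  by (simp add: bounded_clinear_def)

lemma bounded_clinear_plus: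
  "bounded_clinear f \<Longrightarrow> bounded_clinear g \<Longrightarrow> bounded_clinear (\<lambda>x. f x + g x)"
  by (simp add: bounded_clinear_def bounded_linear_add scaleC_add_right)

lemma bounded_clinear_minus:
  "bounded_clinear f \<Longrightarrow> bounded_clinear g \<Longrightarrow> bounded_clinear (\<lambda>x. f x - g x)"
  by (simp add: bounded_clinear_def bounded_linear_sub complex_vector.scale_right_diff_distrib)

lemma bounded_clinear_scaleC_comp:
  "bounded_clinear f \<Longrightarrow> bounded_clinear (\<lambda>x. c *\<^sub>C f x)"
  by (simp add: bounded_clinear_def bounded_linear_compose[OF bounded_linear_scaleC]
      scaleC_scaleC mult.commute)

lemma bounded_clinear_cinner_scaleC: "bounded_clinear (\<lambda>x. cinner x y *\<^sub>C z)"
proof (rule bounded_clinearI[where C = "norm y * norm z"])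
  show "norm (cinner x y *\<^sub>C z) \<le> norm y * norm z * norm x" for x
    using mult_right_mono[OF cinner_Cauchy_Schwarz[of x y], of "norm z"]
    by (simp add: norm_scaleC mult_ac)
qed (simp_all add: cinner_simps scaleC_add_left scaleC_scaleC)

lemma bounded_clinear_cinner_left: "bounded_clinear (\<lambda>x. cinner (x :: 'a::chilbert_space) y)"
  using bounded_clinear_cinner_scaleC[of y "1::complex"] by (simp add: scaleC_complex_def)

lemma continuous_on_cinner_left:
  "continuous_on s f \<Longrightarrow> continuous_on s (\<lambda>x. cinner (f x) (y :: 'a::chilbert_space))"
  using continuous_on_compose2[OF continuous_on_bounded_clinear[OF bounded_clinear_cinner_left]]
  by blast

lemma bounded_ops_iff: "A \<in> bounded_ops \<longleftrightarrow> bounded_clinear (blinfun_apply A)"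
  by (simp add: bounded_ops_def clinear_iff bounded_clinear_def blinfun.bounded_linear_right
      blinfun.add_right)

lemma bounded_clinear_Blinfun:
  assumes "bounded_clinear f"
  shows "Blinfun f \<in> bounded_ops" and "blinfun_apply (Blinfun f) = f"
  using assms by (simp_all add: bounded_ops_iff bounded_linear_Blinfun_apply bounded_clinear_def)

section \<open>Orthogonal projection onto a closed subspace\<close>

abbreviation csubspace :: "'a::complex_vector set \<Rightarrow> bool"
  where "csubspace \<equiv> complex_vector.subspace"

text \<open>Near-minimisers of the distance from \<open>y\<close> form nested closed sets whose
  diameters shrink by the parallelogram law, so completeness yields a minimiser. Its residual is
  orthogonal to \<open>M\<close>, since otherwise subtracting a multiple of some \<open>m\<close>
  would shorten it.\<close>

lemma projection_exists:
  fixes M :: "'a::chilbert_space set"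
  assumes "closed M" and "csubspace M"
  shows "\<exists>p\<in>M. \<forall>m\<in>M. cinner (y - p) m = 0"
proof -
  have 0: "0 \<in> M" using assms(2) by (rule complex_vector.subspace_0)
  define i where "i = (INF m\<in>M. (norm (y - m))\<^sup>2)"
  define F where "F n = {m \<in> M. (norm (y - m))\<^sup>2 \<le> i + 1 / real (Suc n)}" for n
  have bdd: "bdd_below ((\<lambda>m. (norm (y - m))\<^sup>2) ` M)"
    by (rule bdd_belowI[of _ 0]) auto
  have i_le: "i \<le> (norm (y - m))\<^sup>2" if "m \<in> M" for m
    unfolding i_def using bdd that by (rule cINF_lower)
  have closed: "closed (F n)" for n
  proof -
    have "closed (M \<inter> {m. (norm (y - m))\<^sup>2 \<le> i + 1 / real (Suc n)})"
      by (intro closed_Int assms(1) closed_Collect_le continuous_intros)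
    then show ?thesis by (simp add: F_def Collect_conj_eq)
  qed
  have nonempty: "F n \<noteq> {}" for n
  proof -
    have "\<exists>m\<in>M. (norm (y - m))\<^sup>2 < i + 1 / real (Suc n)"
      using cINF_less_iff[OF _ bdd, of "i + 1 / real (Suc n)"] 0 unfolding i_def by fastforce
    then show ?thesis unfolding F_def by (auto intro: less_imp_le)
  qed
  have anti: "F n \<subseteq> F m" if "m \<le> n" for m n
  proof -
    have "1 / real (Suc n) \<le> 1 / real (Suc m)" using that by (simp add: frac_le)
    then show ?thesis unfolding F_def by fastforce
  qed
  have diam: "(dist m m')\<^sup>2 \<le> 4 / real (Suc n)" if "m \<in> F n" "m' \<in> F n" for m m' n
  proof -
    \<comment> \<open>The midpoint lies in \<open>M\<close>, so its squared distance from
      \<open>y\<close> is at least \<open>i\<close>; this bounds the sum term of the parallelogram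
      law from below.\<close>
    define h where "h = (1/2 :: complex) *\<^sub>C (m + m')"
    have "h \<in> M" using that assms(2)
      by (auto simp: h_def F_def complex_vector.subspace_add complex_vector.subspace_scale)
    then have "i \<le> (norm (y - h))\<^sup>2" by (rule i_le)
    moreover have "(y - m) + (y - m') = 2 *\<^sub>C (y - h)"
    proof -
      have "2 *\<^sub>C h = m + m'" by (simp add: h_def scaleC_scaleC)
      moreover have "2 *\<^sub>C y = y + y"
        using scaleC_add_left[of 1 1 y] by simp
      ultimately show ?thesis by (simp add: complex_vector.scale_right_diff_distrib)
    qed
    then have "(norm ((y - m) + (y - m')))\<^sup>2 = 4 * (norm (y - h))\<^sup>2"
      by (simp add: norm_scaleC power_mult_distrib)
    ultimately have "4 * i \<le> (norm ((y - m) + (y - m')))\<^sup>2" by simp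
    moreover have "(norm ((y - m) + (y - m')))\<^sup>2 + (norm ((y - m) - (y - m')))\<^sup>2
        = 2 * (norm (y - m))\<^sup>2 + 2 * (norm (y - m'))\<^sup>2"
      unfolding norm_add_sq norm_diff_sq by simp
    moreover have "norm ((y - m) - (y - m')) = dist m m'"
      by (simp add: dist_norm norm_minus_commute)
    ultimately have "4 * i + (dist m m')\<^sup>2 \<le> 2 * (norm (y - m))\<^sup>2 + 2 * (norm (y - m'))\<^sup>2"
      by (metis add_le_cancel_right)
    moreover have "(norm (y - m))\<^sup>2 \<le> i + 1 / real (Suc n)" "(norm (y - m'))\<^sup>2 \<le> i + 1 / real (Suc n)"
      using that by (auto simp: F_def)
    ultimately have "(dist m m')\<^sup>2 \<le> 4 * (1 / real (Suc n))" by linarith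
    then show ?thesis by simp
  qed
  have "\<exists>n. \<forall>m\<in>F n. \<forall>m'\<in>F n. dist m m' < e" if "0 < e" for e
  proof -
    obtain n where n: "4 / real (Suc n) < e\<^sup>2"
    proof -
      obtain n where "inverse (real (Suc n)) < e\<^sup>2 / 4"
        using reals_Archimedean[of "e\<^sup>2 / 4"] \<open>0 < e\<close> by auto
      then show ?thesis by (intro that[of n]) (simp add: field_simps)
    qed
    have "dist m m' < e" if "m \<in> F n" "m' \<in> F n" for m m'
      using diam[OF that] n \<open>0 < e\<close> by (intro power2_less_imp_less[of "dist m m'" e]) auto
    then show ?thesis by blast
  qed
  then obtain p where p: "\<And>n. p \<in> F n"
    using decreasing_closed_nest[of F] closed nonempty anti by metis
  have pM: "p \<in> M" using p[of 0] by (simp add: F_def)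
  have pmin: "(norm (y - p))\<^sup>2 \<le> i"
  proof (rule field_le_epsilon)
    fix e :: real assume "0 < e"
    then obtain n where "inverse (real (Suc n)) < e" using reals_Archimedean by blast
    then show "(norm (y - p))\<^sup>2 \<le> i + e"
      using p[of n] by (auto simp: F_def divide_inverse)
  qed
  have "cinner (y - p) m = 0" if "m \<in> M" for m
  proof -
    \<comment> \<open>The summand 1 keeps the denominator positive when
      \<open>m = 0\<close>.\<close>
    obtain c where c: "(norm (y - p - c *\<^sub>C m))\<^sup>2
        \<le> (norm (y - p))\<^sup>2 - (cmod (cinner (y - p) m))\<^sup>2 / (norm m + 1)\<^sup>2"
      using exists_scaleC_reducing_norm[of m "norm m + 1" "y - p"]
      by (auto simp: add_nonneg_pos)
    have "p + c *\<^sub>C m \<in> M"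
      using pM that assms(2) by (simp add: complex_vector.subspace_add complex_vector.subspace_scale)
    from i_le[OF this] have "i \<le> (norm (y - p - c *\<^sub>C m))\<^sup>2"
      by (simp add: diff_diff_add)
    with c pmin have "(cmod (cinner (y - p) m))\<^sup>2 / (norm m + 1)\<^sup>2 \<le> 0"
      by linarith
    moreover have "0 < (norm m + 1)\<^sup>2"
      by (intro zero_less_power add_nonneg_pos) auto
    ultimately show ?thesis by (simp add: divide_le_0_iff)
  qed
  with pM show ?thesis by blast
qed

text \<open>Gives the definite description in \<open>orth_proj\<close> its meaning: two candidates
  differ by an element of \<open>M\<close> that is orthogonal to itself.\<close>

lemma orth_proj:
  fixes M :: "'a::chilbert_space set"
  assumes "closed M" and "csubspace M"
  shows orth_proj_in: "orth_proj M y \<in> M"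
    and orth_proj_orthogonal: "\<And>m. m \<in> M \<Longrightarrow> cinner (y - orth_proj M y) m = 0"
proof -
  have "\<exists>!p. p \<in> M \<and> (\<forall>m\<in>M. cinner (y - p) m = 0)"
  proof (rule ex_ex1I)
    show "\<exists>p. p \<in> M \<and> (\<forall>m\<in>M. cinner (y - p) m = 0)"
      using projection_exists[OF assms] by blast
  next
    fix p q
    assume p: "p \<in> M \<and> (\<forall>m\<in>M. cinner (y - p) m = 0)" and q: "q \<in> M \<and> (\<forall>m\<in>M. cinner (y - q) m = 0)"
    then have "p - q \<in> M" using assms(2) by (simp add: complex_vector.subspace_diff)
    then have "cinner ((y - q) - (y - p)) (p - q) = 0"
      using p q by (subst cinner_diff_left) simp
    then show "p = q" by (simp add: cinner_self_eq_0)
  qed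
  from theI'[OF this]
  show "orth_proj M y \<in> M" "\<And>m. m \<in> M \<Longrightarrow> cinner (y - orth_proj M y) m = 0"
    unfolding orth_proj_def by auto
qed

lemma norm_diff_orth_proj_le:
  fixes M :: "'a::chilbert_space set"
  assumes "closed M" and "csubspace M" and "m \<in> M"
  shows "norm (y - orth_proj M y) \<le> norm (y - m)"
proof -
  let ?p = "orth_proj M y"
  have "?p - m \<in> M"
    using orth_proj_in[OF assms(1,2)] assms by (simp add: complex_vector.subspace_diff)
  then have "(norm ((y - ?p) + (?p - m)))\<^sup>2 = (norm (y - ?p))\<^sup>2 + (norm (?p - m))\<^sup>2"
    using orth_proj_orthogonal[OF assms(1,2)] by (subst norm_add_sq) simp
  then have "(norm (y - ?p))\<^sup>2 \<le> (norm (y - m))\<^sup>2" by simp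
  then show ?thesis by (rule power2_le_imp_le) simp
qed

section \<open>Riesz representation and adjoints\<close>

lemma Riesz_representation:
  assumes f: "bounded_clinear (f :: 'a::chilbert_space \<Rightarrow> complex)"
  shows "\<exists>v. \<forall>x. f x = cinner x v"
proof (cases "\<forall>x. f x = 0")
  case True
  then show ?thesis by (intro exI[of _ 0]) simp
next
  case False
  then obtain y where y: "f y \<noteq> 0" by blast
  define M where "M = {x. f x = 0}"
  have "closed M" unfolding M_def
    by (intro closed_Collect_eq continuous_on_bounded_clinear[OF f] continuous_intros)
  moreover have "csubspace M" unfolding M_def
    by (rule complex_vector.subspaceI)
      (simp_all add: bounded_clinear_add[OF f] bounded_clinear_zero[OF f]
        bounded_clinear_scaleC[OF f] scaleC_complex_def)
  ultimately obtain p where p: "p \<in> M" "\<And>m. m \<in> M \<Longrightarrow> cinner (y - p) m = 0"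
    using projection_exists by metis
  define z where "z = y - p"
  have fz: "f z \<noteq> 0"
    using y p(1) by (simp add: z_def M_def bounded_clinear_diff[OF f])
  then have z0: "z \<noteq> 0" using bounded_clinear_zero[OF f] by auto
  have "f x = cinner x ((cnj (f z) / complex_of_real ((norm z)\<^sup>2)) *\<^sub>C z)" for x
  proof -
    \<comment> \<open>\<open>z\<close> is orthogonal to the kernel \<open>M\<close>, so pairing this
      kernel element with \<open>z\<close> expresses \<open>f x\<close> through
      \<open>\<langle>x, z\<rangle>\<close>.\<close>
    have "f z *\<^sub>C x - f x *\<^sub>C z \<in> M"
      by (simp add: M_def bounded_clinear_diff[OF f] bounded_clinear_scaleC[OF f] scaleC_complex_def)
    then have "cinner z (f z *\<^sub>C x - f x *\<^sub>C z) = 0"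
      using p(2) by (simp add: z_def)
    then have "cinner (f z *\<^sub>C x - f x *\<^sub>C z) z = 0"
      by (subst cinner_commute) simp
    then have "f z * cinner x z = f x * complex_of_real ((norm z)\<^sup>2)"
      by (simp add: cinner_simps cinner_self)
    then show ?thesis using z0
      by (simp add: cinner_scaleC_right field_simps del: of_real_power)
  qed
  then show ?thesis by blast
qed

text \<open>The Hilbert space adjoint; for bounded complex-linear \<open>F\<close> the choice is
  justified by Riesz representation. Applied to \<open>t u\<close> it produces slice maps.\<close>

definition cadj :: "('a::chilbert_space \<Rightarrow> 'b::chilbert_space) \<Rightarrow> 'b \<Rightarrow> 'a"
  where "cadj F y = (SOME v. \<forall>x. cinner (F x) y = cinner x v)"

lemma cinner_cadj_right:
  assumes "bounded_clinear F"
  shows "cinner x (cadj F y) = cinner (F x) y"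
proof -
  have "bounded_clinear (\<lambda>x. cinner (F x) y)"
    by (rule bounded_clinear_compose[OF bounded_clinear_cinner_left assms])
  then have "\<exists>v. \<forall>x. cinner (F x) y = cinner x v" by (rule Riesz_representation)
  from someI_ex[OF this] show ?thesis unfolding cadj_def by metis
qed

lemma cinner_cadj_left:
  "bounded_clinear F \<Longrightarrow> cinner (cadj F y) x = cinner y (F x)"
  by (subst (1 2) cinner_commute) (simp add: cinner_cadj_right)

lemma norm_cadj_le:
  assumes "bounded_clinear F" and "0 \<le> C" and C: "\<And>x. norm (F x) \<le> C * norm x"
  shows "norm (cadj F y) \<le> C * norm y"
proof (cases "cadj F y = 0")
  case True
  with assms(2) show ?thesis by simp
next
  case False
  let ?z = "cadj F y"
  have "complex_of_real ((norm ?z)\<^sup>2) = cinner (F ?z) y"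
    by (metis assms(1) cinner_cadj_right cinner_self)
  then have "(norm ?z)\<^sup>2 = cmod (cinner (F ?z) y)"
    by (metis abs_power2 norm_of_real power2_abs)
  also have "\<dots> \<le> norm (F ?z) * norm y" by (rule cinner_Cauchy_Schwarz)
  also have "\<dots> \<le> C * norm ?z * norm y" by (intro mult_right_mono C) simp
  finally have "norm ?z * norm ?z \<le> norm ?z * (C * norm y)"
    by (simp add: power2_eq_square mult_ac)
  then show ?thesis using False by simp
qed

lemma bounded_clinear_cadj:
  assumes F: "bounded_clinear F"
  shows "bounded_clinear (cadj F)"
proof -
  obtain C where "0 < C" "\<And>x. norm (F x) \<le> C * norm x"
    using bounded_clinear_bound[OF F] by blast
  then have "norm (cadj F y) \<le> C * norm y" for y
    by (intro norm_cadj_le F) auto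
  then show ?thesis
  proof (intro bounded_clinearI[where C = C])
    show "cadj F (x + y) = cadj F x + cadj F y" for x y
      by (rule cinner_ext) (simp add: cinner_cadj_right[OF F] cinner_simps)
    show "cadj F (c *\<^sub>C x) = c *\<^sub>C cadj F x" for c x
      by (rule cinner_ext) (simp add: cinner_cadj_right[OF F] cinner_simps)
  qed
qed

section \<open>The operators \<open>T \<otimes> B\<close>\<close>

lemma csubspace_closure:
  fixes M :: "'a::chilbert_space set"
  assumes "csubspace M"
  shows "csubspace (closure M)"
proof (rule complex_vector.subspaceI)
  show "0 \<in> closure M"
    using complex_vector.subspace_0[OF assms] closure_subset by blast
next
  fix x y assume "x \<in> closure M" "y \<in> closure M"
  then obtain f g where "\<And>n. f n \<in> M" "f \<longlonglongrightarrow> x" "\<And>n. g n \<in> M" "g \<longlonglongrightarrow> y"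
    unfolding closure_sequential by blast
  then show "x + y \<in> closure M"
    unfolding closure_sequential using assms
    by (intro exI[of _ "\<lambda>n. f n + g n"]) (auto intro: tendsto_add complex_vector.subspace_add)
next
  fix c x assume "x \<in> closure M"
  then obtain f where "\<And>n. f n \<in> M" "f \<longlonglongrightarrow> x"
    unfolding closure_sequential by blast
  then show "c *\<^sub>C x \<in> closure M"
    unfolding closure_sequential using assms
    by (intro exI[of _ "\<lambda>n. c *\<^sub>C f n"])
      (auto intro: bounded_linear.tendsto[OF bounded_linear_scaleC] complex_vector.subspace_scale)
qed

text \<open>The map is given by a relation so that well-definedness need not be shown beforehand:
  the norm bound, applied to differences of pairs, forces uniqueness of values. \<open>Q\<close> is
  the sequential closure of the graph, and completeness of the target makes it total.\<close>

lemma bounded_clinear_extension: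
  fixes R :: "'a::chilbert_space \<Rightarrow> 'b::chilbert_space \<Rightarrow> bool"
  assumes add: "\<And>x y x' y'. R x y \<Longrightarrow> R x' y' \<Longrightarrow> R (x + x') (y + y')"
    and scale: "\<And>c x y. R x y \<Longrightarrow> R (c *\<^sub>C x) (c *\<^sub>C y)"
    and bound: "\<And>x y. R x y \<Longrightarrow> norm y \<le> C * norm x"
    and dense: "closure {x. \<exists>y. R x y} = UNIV"
  shows "\<exists>D. bounded_clinear D \<and> (\<forall>x y. R x y \<longrightarrow> D x = y)"
proof -
  define Q where "Q x y \<longleftrightarrow> (\<exists>f g. (\<forall>n. R (f n) (g n)) \<and> f \<longlonglongrightarrow> x \<and> g \<longlonglongrightarrow> y)" for x y
  have diff: "R (x - x') (y - y')" if "R x y" "R x' y'" for x x' y y'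
    using add[OF that(1) scale[OF that(2), of "- 1"]] by simp
  have Q_add: "Q (x + x') (y + y')" if "Q x y" "Q x' y'" for x x' y y'
  proof -
    from that obtain f g f' g' where "\<And>n. R (f n) (g n)" "f \<longlonglongrightarrow> x" "g \<longlonglongrightarrow> y"
      "\<And>n. R (f' n) (g' n)" "f' \<longlonglongrightarrow> x'" "g' \<longlonglongrightarrow> y'" unfolding Q_def by blast
    then show ?thesis unfolding Q_def
      by (intro exI[of _ "\<lambda>n. f n + f' n"] exI[of _ "\<lambda>n. g n + g' n"])
        (auto intro: add tendsto_add)
  qed
  have Q_scale: "Q (c *\<^sub>C x) (c *\<^sub>C y)" if "Q x y" for c x y
  proof -
    from that obtain f g where "\<And>n. R (f n) (g n)" "f \<longlonglongrightarrow> x" "g \<longlonglongrightarrow> y"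
      unfolding Q_def by blast
    then show ?thesis unfolding Q_def
      by (intro exI[of _ "\<lambda>n. c *\<^sub>C f n"] exI[of _ "\<lambda>n. c *\<^sub>C g n"])
        (auto intro: scale bounded_linear.tendsto[OF bounded_linear_scaleC])
  qed
  have Q_bound: "norm y \<le> C * norm x" if "Q x y" for x y
  proof -
    from that obtain f g where fg: "\<And>n. R (f n) (g n)" "f \<longlonglongrightarrow> x" "g \<longlonglongrightarrow> y"
      unfolding Q_def by blast
    show ?thesis
      by (rule LIMSEQ_le[OF tendsto_norm[OF fg(3)] tendsto_mult_left[OF tendsto_norm[OF fg(2)]]])
        (use bound fg(1) in blast)
  qed
  have Q_unique: "y = y'" if "Q x y" "Q x y'" for x y y'
    using Q_bound[OF Q_add[OF that(1) Q_scale[OF that(2), of "- 1"]]] by simp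
  have Q_total: "\<exists>y. Q x y" for x
  proof -
    have "x \<in> closure {x. \<exists>y. R x y}" using dense by simp
    then obtain f where f: "\<And>n. \<exists>y. R (f n) y" "f \<longlonglongrightarrow> x"
      unfolding closure_sequential by blast
    then obtain g where g: "\<And>n. R (f n) (g n)" by metis
    have "Cauchy g"
    proof (rule metric_CauchyI)
      fix e :: real assume "0 < e"
      \<comment> \<open>Nothing is assumed about the sign of \<open>C\<close>, so
        \<open>\<bar>C\<bar> + 1\<close> serves as a positive Lipschitz constant.\<close>
      define \<delta> where "\<delta> = e / (\<bar>C\<bar> + 1)"
      have "0 < \<delta>" using \<open>0 < e\<close> by (simp add: \<delta>_def)
      then obtain N where N: "\<And>m n. m \<ge> N \<Longrightarrow> n \<ge> N \<Longrightarrow> dist (f m) (f n) < \<delta>"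
        using LIMSEQ_imp_Cauchy[OF f(2)] metric_CauchyD by blast
      have "dist (g m) (g n) < e" if "m \<ge> N" "n \<ge> N" for m n
      proof -
        have "dist (g m) (g n) \<le> C * dist (f m) (f n)"
          unfolding dist_norm by (intro bound diff g)
        also have "\<dots> \<le> (\<bar>C\<bar> + 1) * dist (f m) (f n)"
          by (intro mult_right_mono) auto
        also have "\<dots> < (\<bar>C\<bar> + 1) * \<delta>"
          using N[OF that] by (intro mult_strict_left_mono) auto
        also have "\<dots> = e" by (simp add: \<delta>_def)
        finally show ?thesis .
      qed
      then show "\<exists>N. \<forall>m\<ge>N. \<forall>n\<ge>N. dist (g m) (g n) < e" by blast
    qed
    then obtain y where "g \<longlonglongrightarrow> y"
      using Cauchy_convergent_iff convergent_def by blast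
    then show ?thesis unfolding Q_def using f(2) g by blast
  qed
  then obtain D where D: "\<And>x. Q x (D x)" by metis
  have "bounded_clinear D"
    by (rule bounded_clinearI[where C = C])
      (blast intro: D Q_unique Q_add, blast intro: D Q_unique Q_scale, blast intro: D Q_bound)
  moreover have "D x = y" if "R x y" for x y
  proof -
    have "Q x y" unfolding Q_def
      using that by (intro exI[of _ "\<lambda>_. x"] exI[of _ "\<lambda>_. y"]) simp
    then show ?thesis using D Q_unique by blast
  qed
  ultimately show ?thesis by blast
qed

section \<open>Elementary tensors, slices and tensor products of operators\<close>

lemma hilbert_tensor_swap:
  assumes "hilbert_tensor t"
  shows "hilbert_tensor (\<lambda>y x. t x y)"
proof -
  have "{t x y | x y. True} = {t x y | y x. True}" by blast
  then show ?thesis using assms by (auto simp: hilbert_tensor_def)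
qed

context
  fixes t :: "'h::chilbert_space \<Rightarrow> 'k::chilbert_space \<Rightarrow> 'l::chilbert_space"
  assumes t: "hilbert_tensor t"
begin

lemma cinner_tensor: "cinner (t x y) (t x' y') = cinner x x' * cinner y y'"
  using t by (simp add: hilbert_tensor_def)

lemma norm_tensor: "norm (t x y) = norm x * norm y"
proof -
  have "complex_of_real ((norm (t x y))\<^sup>2) = complex_of_real ((norm x * norm y)\<^sup>2)"
    unfolding cinner_self[symmetric] cinner_tensor
    by (simp add: cinner_self power_mult_distrib)
  then have "(norm (t x y))\<^sup>2 = (norm x * norm y)\<^sup>2" by (simp only: of_real_eq_iff)
  then show ?thesis by (simp add: power2_eq_iff_nonneg)
qed

lemma tensor_add_left: "t (x + x') y = t x y + t x' y"
  and tensor_scaleC_left: "t (c *\<^sub>C x) y = c *\<^sub>C t x y"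
  and tensor_add_right: "t x (y + y') = t x y + t x y'"
  and tensor_scaleC_right: "t x (c *\<^sub>C y) = c *\<^sub>C t x y"
  using t by (auto simp: hilbert_tensor_def clinear_iff)

lemma bounded_clinear_tensor_left: "bounded_clinear (\<lambda>x. t x y)"
  by (rule bounded_clinearI[where C = "norm y"])
    (simp_all add: tensor_add_left tensor_scaleC_left norm_tensor)

lemma bounded_clinear_tensor_right: "bounded_clinear (t x)"
  by (rule bounded_clinearI[where C = "norm x"])
    (simp_all add: tensor_add_right tensor_scaleC_right norm_tensor)

lemma tensor_dense:
  assumes "closed M" and "csubspace M" and "\<And>x y. t x y \<in> M"
  shows "z \<in> M"
proof -
  have "cspan {t x y | x y. True} \<subseteq> M"
    using assms by (intro complex_vector.span_minimal) auto
  then have "closure (cspan {t x y | x y. True}) \<subseteq> M"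
    using assms(1) by (rule closure_minimal)
  then show ?thesis using t by (auto simp: hilbert_tensor_def)
qed

lemma bounded_clinear_eq_on_tensors:
  assumes F: "bounded_clinear F" and G: "bounded_clinear G" and "\<And>x y. F (t x y) = G (t x y)"
  shows "F z = G z"
proof -
  have "z \<in> {z. F z = G z}"
  proof (rule tensor_dense)
    show "closed {z. F z = G z}"
      by (intro closed_Collect_eq continuous_on_bounded_clinear F G)
    show "csubspace {z. F z = G z}"
      by (rule complex_vector.subspaceI)
        (simp_all add: bounded_clinear_add[OF F] bounded_clinear_add[OF G]
          bounded_clinear_zero[OF F] bounded_clinear_zero[OF G]
          bounded_clinear_scaleC[OF F] bounded_clinear_scaleC[OF G])
  qed (use assms in simp)
  then show ?thesis by simp
qed

lemma cinner_tensor_ext: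
  assumes "\<And>x y. cinner z (t x y) = cinner w (t x y)"
  shows "z = w"
proof -
  have "cinner (t x y) z = cinner (t x y) w" for x y
    using assms by (subst (1 2) cinner_commute) simp
  then have "cinner v z = cinner v w" for v
    by (rule bounded_clinear_eq_on_tensors[OF bounded_clinear_cinner_left bounded_clinear_cinner_left])
  then show ?thesis by (rule cinner_ext)
qed

text \<open>This and the next lemma identify the adjoints of
  \<open>x \<mapsto> u \<otimes> x\<close> and \<open>x \<mapsto> x \<otimes> v\<close> as the slice
  maps that contract one leg.\<close>

lemma cadj_tensor_right: "cadj (t u) (t x y) = cinner x u *\<^sub>C y"
  by (rule cinner_ext)
    (simp add: cinner_cadj_right[OF bounded_clinear_tensor_right] cinner_tensor cinner_scaleC_right
      flip: cinner_commute)

lemma cadj_tensor_left: "cadj (\<lambda>x. t x v) (t x y) = cinner y v *\<^sub>C x"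
  by (rule cinner_ext)
    (simp add: cinner_cadj_right[OF bounded_clinear_tensor_left] cinner_tensor cinner_scaleC_right
      mult.commute flip: cinner_commute)

text \<open>The graph of \<open>A \<otimes> 1\<close> on finite sums of elementary tensors. A
  relation is used because such a sum has many representations; single-valuedness comes from the
  norm bound.\<close>

inductive tensor_left_graph :: "('h \<Rightarrow> 'h) \<Rightarrow> 'l \<Rightarrow> 'l \<Rightarrow> bool" for A where
  zero: "tensor_left_graph A 0 0"
| step: "tensor_left_graph A z z' \<Longrightarrow> tensor_left_graph A (z + t x y) (z' + t (A x) y)"

lemma tensor_left_graph_add:
  assumes "tensor_left_graph A w w'" and "tensor_left_graph A z z'"
  shows "tensor_left_graph A (z + w) (z' + w')"
  using assms by (induction rule: tensor_left_graph.induct)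
    (simp_all add: tensor_left_graph.step flip: add.assoc)

lemma tensor_left_graph_scaleC:
  assumes "tensor_left_graph A z z'" and A: "bounded_clinear A"
  shows "tensor_left_graph A (c *\<^sub>C z) (c *\<^sub>C z')"
  using assms(1)
proof (induction rule: tensor_left_graph.induct)
  case zero
  then show ?case by (simp add: tensor_left_graph.zero)
next
  case (step z z' x y)
  from tensor_left_graph.step[OF step.IH, of "c *\<^sub>C x" y] show ?case
    by (simp add: scaleC_add_right tensor_scaleC_left bounded_clinear_scaleC[OF A])
qed

lemma tensor_left_graph_total:
  assumes "z \<in> cspan {t x y | x y. True}"
  shows "\<exists>z'. tensor_left_graph A z z'"
  using assms
proof (induction rule: complex_vector.span_induct_alt)
  case base
  then show ?case using tensor_left_graph.zero by blast
next
  case (step c w z)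
  then obtain x y z' where "w = t x y" "tensor_left_graph A z z'" by blast
  from tensor_left_graph.step[OF this(2), of "c *\<^sub>C x" y] this(1)
  show ?case by (auto simp: tensor_scaleC_left add.commute)
qed

text \<open>Orthonormalising the right legs makes the norm of a finite tensor computable.\<close>

lemma tensor_left_graph_orthonormal:
  assumes "tensor_left_graph A z z'" and A: "bounded_clinear A"
  shows "\<exists>F X. finite F \<and> (\<forall>f\<in>F. \<forall>g\<in>F. cinner f g = (if f = g then 1 else 0))
    \<and> z = (\<Sum>f\<in>F. t (X f) f) \<and> z' = (\<Sum>f\<in>F. t (A (X f)) f)"
  using assms(1)
proof (induction rule: tensor_left_graph.induct)
  case zero
  show ?case by (intro exI[of _ "{}"]) simp
next
  case (step z z' x y)
  then obtain F X where F: "finite F" "\<And>f g. f \<in> F \<Longrightarrow> g \<in> F \<Longrightarrow> cinner f g = (if f = g then 1 else 0)"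
    and z: "z = (\<Sum>f\<in>F. t (X f) f)" "z' = (\<Sum>f\<in>F. t (A (X f)) f)" by auto
  \<comment> \<open>Gram-Schmidt: \<open>e\<close> is the part of \<open>y\<close> orthogonal to
    \<open>F\<close>, and the remaining part of \<open>x \<otimes> y\<close> is absorbed into the
    left legs \<open>X'\<close>.\<close>
  define e where "e = y - (\<Sum>f\<in>F. cinner y f *\<^sub>C f)"
  define X' where "X' f = X f + cinner y f *\<^sub>C x" for f
  have e_orth: "cinner e g = 0" if "g \<in> F" for g
  proof -
    have "cinner (\<Sum>f\<in>F. cinner y f *\<^sub>C f) g = (\<Sum>f\<in>F. if f = g then cinner y f else 0)"
      unfolding cinner_sum_left using F(2) that by (intro sum.cong) (auto simp: cinner_scaleC_left)
    then show ?thesis using F(1) that by (simp add: e_def cinner_diff_left)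
  qed
  have y: "t w y = t w e + (\<Sum>f\<in>F. t (cinner y f *\<^sub>C w) f)" for w
  proof -
    have "y = e + (\<Sum>f\<in>F. cinner y f *\<^sub>C f)" by (simp add: e_def)
    then have "t w y = t w e + t w (\<Sum>f\<in>F. cinner y f *\<^sub>C f)"
      using tensor_add_right by metis
    also have "t w (\<Sum>f\<in>F. cinner y f *\<^sub>C f) = (\<Sum>f\<in>F. t w (cinner y f *\<^sub>C f))"
      by (rule linear_sum[OF bounded_linear.linear[OF bounded_clinear_bounded_linear[OF bounded_clinear_tensor_right]]])
    finally show ?thesis by (simp add: tensor_scaleC_left tensor_scaleC_right)
  qed
  have zy: "z + t x y = t x e + (\<Sum>f\<in>F. t (X' f) f)"
    and zy': "z' + t (A x) y = t (A x) e + (\<Sum>f\<in>F. t (A (X' f)) f)"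
    by (simp_all add: z y X'_def tensor_add_left sum.distrib bounded_clinear_add[OF A]
        bounded_clinear_scaleC[OF A])
  show ?case
  \<comment> \<open>If \<open>y\<close> already lies in the span of \<open>F\<close>, the family
    stays; otherwise the normalised \<open>e\<close> joins it and its length moves to the left
    leg.\<close>
  proof (cases "e = 0")
    case True
    have "t w 0 = 0" for w by (rule bounded_clinear_zero[OF bounded_clinear_tensor_right])
    with True show ?thesis
      unfolding zy zy' using F by (intro exI[of _ F] exI[of _ X']) simp
  next
    case False
    define n where "n = complex_of_real (norm e)"
    define e' where "e' = inverse n *\<^sub>C e"
    have n0: "n \<noteq> 0" using False by (simp add: n_def)
    have ne: "t w e = t (n *\<^sub>C w) e'" for w
      using n0 by (simp add: e'_def tensor_scaleC_left tensor_scaleC_right scaleC_scaleC)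
    have e'1: "cinner e' e' = 1"
      using False by (simp add: cinner_self e'_def norm_scaleC n_def norm_inverse)
    have e'0: "cinner e' g = 0" "cinner g e' = 0" if "g \<in> F" for g
    proof -
      show "cinner e' g = 0" using e_orth[OF that] by (simp add: e'_def cinner_scaleC_left)
      then show "cinner g e' = 0" by (subst cinner_commute) simp
    qed
    have e'F: "e' \<notin> F" using e'0 e'1 by force
    have "z + t x y = (\<Sum>f\<in>insert e' F. t ((X'(e' := n *\<^sub>C x)) f) f)"
      unfolding zy ne using F(1) e'F by (simp, intro sum.cong) auto
    moreover have "z' + t (A x) y = (\<Sum>f\<in>insert e' F. t (A ((X'(e' := n *\<^sub>C x)) f)) f)"
      unfolding zy' ne using F(1) e'F
      by (simp add: bounded_clinear_scaleC[OF A], intro sum.cong) auto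
    moreover have "cinner f g = (if f = g then 1 else 0)" if "f \<in> insert e' F" "g \<in> insert e' F" for f g
      using that F(2) e'0 e'1 e'F by auto
    ultimately show ?thesis using F(1)
      by (intro exI[of _ "insert e' F"] exI[of _ "X'(e' := n *\<^sub>C x)"]) blast
  qed
qed

lemma norm_sum_tensor_orthonormal:
  assumes "finite F" and "\<And>f g. f \<in> F \<Longrightarrow> g \<in> F \<Longrightarrow> cinner f g = (if f = g then 1 else 0)"
  shows "(norm (\<Sum>f\<in>F. t (X f) f))\<^sup>2 = (\<Sum>f\<in>F. (norm (X f))\<^sup>2)"
proof -
  have "cinner (\<Sum>f\<in>F. t (X f) f) (\<Sum>f\<in>F. t (X f) f)
      = (\<Sum>f\<in>F. \<Sum>g\<in>F. if f = g then cinner (X f) (X f) else 0)"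
    unfolding cinner_sum_left cinner_sum_right using assms(2)
    by (subst sum.swap, intro sum.cong) (auto simp: cinner_tensor)
  also have "\<dots> = (\<Sum>f\<in>F. cinner (X f) (X f))"
    using assms(1) by (simp add: sum.delta)
  finally show ?thesis
    unfolding Re_cinner_self[symmetric] by simp
qed

text \<open>With orthonormal right legs both squared norms are sums of squared norms of left legs,
  which compare term by term.\<close>

lemma norm_tensor_left_graph:
  assumes "tensor_left_graph A z z'" and "bounded_clinear A" and "0 \<le> C"
    and C: "\<And>x. norm (A x) \<le> C * norm x"
  shows "norm z' \<le> C * norm z"
proof -
  from tensor_left_graph_orthonormal[OF assms(1,2)]
  obtain F X where F: "finite F" "\<And>f g. f \<in> F \<Longrightarrow> g \<in> F \<Longrightarrow> cinner f g = (if f = g then 1 else 0)"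
    and z: "z = (\<Sum>f\<in>F. t (X f) f)" "z' = (\<Sum>f\<in>F. t (A (X f)) f)" by blast
  have "(norm z')\<^sup>2 = (\<Sum>f\<in>F. (norm (A (X f)))\<^sup>2)"
    unfolding z by (rule norm_sum_tensor_orthonormal[OF F])
  also have "\<dots> \<le> (\<Sum>f\<in>F. (C * norm (X f))\<^sup>2)"
    by (intro sum_mono power_mono C) simp
  also have "\<dots> = C\<^sup>2 * (\<Sum>f\<in>F. (norm (X f))\<^sup>2)"
    by (simp add: power_mult_distrib sum_distrib_left)
  also have "(\<Sum>f\<in>F. (norm (X f))\<^sup>2) = (norm z)\<^sup>2"
    unfolding z by (rule norm_sum_tensor_orthonormal[OF F, symmetric])
  finally have "(norm z')\<^sup>2 \<le> (C * norm z)\<^sup>2" by (simp add: power_mult_distrib)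
  then show ?thesis by (rule power2_le_imp_le) (use assms(3) in simp)
qed

lemma tensor_left_exists:
  assumes A: "bounded_clinear A"
  shows "\<exists>D. bounded_clinear D \<and> (\<forall>x y. D (t x y) = t (A x) y)"
proof -
  obtain C where "0 < C" and C: "\<And>x. norm (A x) \<le> C * norm x"
    using bounded_clinear_bound[OF A] by blast
  have "\<exists>D. bounded_clinear D \<and> (\<forall>z z'. tensor_left_graph A z z' \<longrightarrow> D z = z')"
  proof (rule bounded_clinear_extension[where C = C])
    have "cspan {t x y | x y. True} \<subseteq> {z. \<exists>z'. tensor_left_graph A z z'}"
      using tensor_left_graph_total by blast
    from closure_mono[OF this] show "closure {z. \<exists>z'. tensor_left_graph A z z'} = UNIV"
      using t by (auto simp: hilbert_tensor_def)
  qed (use \<open>0 < C\<close> in \<open>auto intro: tensor_left_graph_add tensor_left_graph_scaleC A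
      norm_tensor_left_graph C\<close>)
  then obtain D where D: "bounded_clinear D" "\<And>z z'. tensor_left_graph A z z' \<Longrightarrow> D z = z'" by blast
  have "D (t x y) = t (A x) y" for x y
    using D(2)[OF tensor_left_graph.step[OF tensor_left_graph.zero]] by simp
  with D(1) show ?thesis by blast
qed

end

text \<open>\<open>A \<otimes> B\<close> is the composition of \<open>A \<otimes> 1\<close> and
  \<open>1 \<otimes> B\<close>; the second factor is the first construction with the legs
  swapped.\<close>

lemma tensor_exists:
  fixes t :: "'h::chilbert_space \<Rightarrow> 'k::chilbert_space \<Rightarrow> 'l::chilbert_space"
  assumes t: "hilbert_tensor t" and "bounded_clinear A" and "bounded_clinear B"
  shows "\<exists>D. bounded_clinear D \<and> (\<forall>x y. D (t x y) = t (A x) (B y))"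
proof -
  obtain D E where "bounded_clinear D" "\<And>x y. D (t x y) = t (A x) y"
    "bounded_clinear E" "\<And>x y. E (t x y) = t x (B y)"
    using tensor_left_exists[OF t assms(2)] tensor_left_exists[OF hilbert_tensor_swap[OF t] assms(3)]
    by blast
  then show ?thesis
    by (intro exI[of _ "\<lambda>z. D (E z)"]) (simp add: bounded_clinear_compose)
qed

lemma bounded_ops_eq_on_tensors:
  assumes "hilbert_tensor t" and "D \<in> bounded_ops" and "E \<in> bounded_ops"
    and "\<And>x y. blinfun_apply D (t x y) = blinfun_apply E (t x y)"
  shows "D = E"
  using bounded_clinear_eq_on_tensors[OF assms(1), of "blinfun_apply D" "blinfun_apply E"] assms(2-)
  by (intro blinfun_eqI) (simp add: bounded_ops_iff)

text \<open>Gives the definite description in \<open>tensor_op\<close> its meaning; uniqueness holds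
  because elementary tensors span a dense subspace.\<close>

lemma tensor_op:
  assumes t: "hilbert_tensor t" and "A \<in> bounded_ops" and "B \<in> bounded_ops"
  shows tensor_op_in: "tensor_op t A B \<in> bounded_ops"
    and tensor_op_apply: "\<And>x y. tensor_op t A B (t x y) = t (A x) (B y)"
proof -
  have "\<exists>!D. D \<in> bounded_ops \<and> (\<forall>x y. blinfun_apply D (t x y) = t (A x) (B y))"
  proof (rule ex_ex1I)
    obtain D where D: "bounded_clinear D" "\<And>x y. D (t x y) = t (A x) (B y)"
      using tensor_exists[OF t] assms(2,3) unfolding bounded_ops_iff by blast
    show "\<exists>D. D \<in> bounded_ops \<and> (\<forall>x y. blinfun_apply D (t x y) = t (A x) (B y))"
      by (intro exI[of _ "Blinfun D"]) (simp add: D bounded_clinear_Blinfun)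
  next
    fix D E
    assume "D \<in> bounded_ops \<and> (\<forall>x y. blinfun_apply D (t x y) = t (A x) (B y))"
      "E \<in> bounded_ops \<and> (\<forall>x y. blinfun_apply E (t x y) = t (A x) (B y))"
    then show "D = E"
      by (intro bounded_ops_eq_on_tensors[OF t]) simp_all
  qed
  from theI'[OF this]
  show "tensor_op t A B \<in> bounded_ops" "\<And>x y. tensor_op t A B (t x y) = t (A x) (B y)"
    unfolding tensor_op_def by auto
qed

section \<open>The weak operator topology and the space of bounded operators\<close>

lemma topspace_wot: "topspace wot = bounded_ops"
proof -
  let ?G = "{{A \<in> bounded_ops. cinner (blinfun_apply A x) y \<in> U} | x y U. open U}"
  have "\<Union> ?G \<subseteq> bounded_ops" by blast
  \<comment> \<open>This subbasic set is all of \<open>bounded_ops\<close>.\<close>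
  moreover have "{A \<in> bounded_ops. cinner (blinfun_apply A 0) 0 \<in> UNIV} \<in> ?G"
    by (intro CollectI exI conjI) (rule refl, rule open_UNIV)
  then have "bounded_ops \<subseteq> \<Union> ?G"
    by (intro Union_upper) simp
  ultimately show ?thesis
    unfolding wot_def topology_generated_by_topspace by (rule subset_antisym)
qed

lemma continuous_map_wot_cinner:
  "continuous_map wot euclidean (\<lambda>A. cinner (blinfun_apply A x) y)"
proof -
  have "openin wot {A \<in> topspace wot. cinner (blinfun_apply A x) y \<in> U}" if "open U" for U
    unfolding topspace_wot unfolding wot_def
    by (rule topology_generated_by_Basis) (use that in blast)
  then show ?thesis by (simp add: continuous_map_def)
qed

lemma blinfun_scaleC_apply: "blinfun_apply (c *\<^sub>C A) x = c *\<^sub>C blinfun_apply A x"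
  by (simp add: scaleC_blinfun.rep_eq)

lemma bounded_ops_alt: "bounded_ops = {A. \<forall>c x. blinfun_apply A (c *\<^sub>C x) = c *\<^sub>C blinfun_apply A x}"
  by (auto simp: bounded_ops_iff bounded_clinear_def blinfun.bounded_linear_right)

lemma csubspace_bounded_ops: "csubspace (bounded_ops :: ('a::chilbert_space \<Rightarrow>\<^sub>L 'a) set)"
  by (rule complex_vector.subspaceI)
    (simp_all add: bounded_ops_alt blinfun.add_left scaleC_add_right blinfun_scaleC_apply
      scaleC_scaleC mult.commute)

lemma closed_bounded_ops: "closed (bounded_ops :: ('a::chilbert_space \<Rightarrow>\<^sub>L 'a) set)"
  unfolding bounded_ops_alt
  by (intro closed_Collect_all closed_Collect_eq continuous_intros
      bounded_linear.continuous_on[OF bounded_linear_scaleC])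

text \<open>The concrete form of the weakly closed space. Testing on elementary tensors avoids the
  definite description in \<open>tensor_op\<close>.\<close>

definition tensor_ops ::
    "('h::chilbert_space \<Rightarrow> 'k::chilbert_space \<Rightarrow> 'l::chilbert_space) \<Rightarrow> ('h \<Rightarrow>\<^sub>L 'h) \<Rightarrow> ('l \<Rightarrow>\<^sub>L 'l) set"
  where "tensor_ops t T = {D \<in> bounded_ops. \<exists>B\<in>bounded_ops. \<forall>x y. D (t x y) = t (T x) (B y)}"

text \<open>The operators \<open>T \<otimes> B\<close> are those whose matrix coefficients split off a factor
  \<open>\<langle>T x, x'\<rangle>\<close>; these are linear conditions that survive weak limits.\<close>

lemma tensor_ops_eq_coefficients:
  assumes t: "hilbert_tensor t" and T: "T \<in> bounded_ops" and "T \<noteq> 0"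
  shows "tensor_ops t T = {D \<in> bounded_ops. \<forall>x x' w w' y y'.
    cinner (D (t x y)) (t x' y') * cinner (T w) w' = cinner (D (t w y)) (t w' y') * cinner (T x) x'}"
    (is "_ = ?W")
proof
  show "tensor_ops t T \<subseteq> ?W"
    by (auto simp: tensor_ops_def cinner_tensor[OF t])
next
  show "?W \<subseteq> tensor_ops t T"
  proof
    fix D assume D: "D \<in> ?W"
    then have Dl: "bounded_clinear (blinfun_apply D)" by (simp add: bounded_ops_iff)
    obtain w where w: "T w \<noteq> 0" using \<open>T \<noteq> 0\<close> blinfun_eqI by (metis blinfun.zero_left)
    \<comment> \<open>The scaling makes \<open>\<langle>T w, w'\<rangle> = 1\<close>, so slicing
      \<open>D (w \<otimes> y)\<close> against \<open>w'\<close> recovers the right factor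
      \<open>B y\<close>.\<close>
    define w' where "w' = complex_of_real (inverse ((norm (T w))\<^sup>2)) *\<^sub>C T w"
    have w': "cinner (T w) w' = 1"
      using w by (simp add: w'_def cinner_scaleC_right cinner_self)
    define B where "B y = cadj (t w') (D (t w y))" for y
    have B: "bounded_clinear B"
      unfolding B_def
      by (intro bounded_clinear_compose[OF bounded_clinear_cadj] bounded_clinear_compose[OF Dl]
          bounded_clinear_tensor_right[OF t])
    have "D (t x y) = t (T x) (B y)" for x y
    proof (rule cinner_tensor_ext[OF t])
      fix x' y'
      have "cinner (D (t x y)) (t x' y') = cinner (D (t w y)) (t w' y') * cinner (T x) x'"
        using D w' by (metis (mono_tags, lifting) mem_Collect_eq mult.right_neutral)
      then show "cinner (D (t x y)) (t x' y') = cinner (t (T x) (B y)) (t x' y')"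
        by (simp add: B_def cinner_tensor[OF t] cinner_cadj_left bounded_clinear_tensor_right[OF t])
    qed
    then show "D \<in> tensor_ops t T"
      using D bounded_clinear_Blinfun[OF B]
      unfolding tensor_ops_def by (intro CollectI conjI bexI[of _ "Blinfun B"]) simp_all
  qed
qed

lemma csubspace_tensor_ops:
  assumes t: "hilbert_tensor t"
  shows "csubspace (tensor_ops t T)"
proof (rule complex_vector.subspaceI)
  have "t x 0 = 0" for x by (rule bounded_clinear_zero[OF bounded_clinear_tensor_right[OF t]])
  then show "0 \<in> tensor_ops t T"
    unfolding tensor_ops_def
    by (intro CollectI conjI bexI[of _ 0]) (simp_all add: complex_vector.subspace_0[OF csubspace_bounded_ops])
next
  fix D E assume "D \<in> tensor_ops t T" "E \<in> tensor_ops t T"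
  then obtain B C where "D \<in> bounded_ops" "E \<in> bounded_ops" "B \<in> bounded_ops" "C \<in> bounded_ops"
    "\<And>x y. D (t x y) = t (T x) (B y)" "\<And>x y. E (t x y) = t (T x) (C y)"
    unfolding tensor_ops_def by blast
  then show "D + E \<in> tensor_ops t T"
    unfolding tensor_ops_def
    by (intro CollectI conjI bexI[of _ "B + C"])
      (simp_all add: complex_vector.subspace_add[OF csubspace_bounded_ops] blinfun.add_left
        tensor_add_right[OF t])
next
  fix c D assume "D \<in> tensor_ops t T"
  then obtain B where "D \<in> bounded_ops" "B \<in> bounded_ops" "\<And>x y. D (t x y) = t (T x) (B y)"
    unfolding tensor_ops_def by blast
  then show "c *\<^sub>C D \<in> tensor_ops t T"
    unfolding tensor_ops_def
    by (intro CollectI conjI bexI[of _ "c *\<^sub>C B"])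
      (simp_all add: complex_vector.subspace_scale[OF csubspace_bounded_ops] blinfun_scaleC_apply
        tensor_scaleC_right[OF t])
qed

lemma closed_tensor_ops:
  assumes "hilbert_tensor t" and "T \<in> bounded_ops" and "T \<noteq> 0"
  shows "closed (tensor_ops t T)"
  unfolding tensor_ops_eq_coefficients[OF assms] Collect_conj_eq Collect_mem_eq
  by (intro closed_Int closed_bounded_ops closed_Collect_all closed_Collect_eq continuous_intros
      continuous_on_cinner_left)

text \<open>The generators lie in \<open>tensor_ops t T\<close>, a norm-closed subspace cut out by
  weakly closed coefficient equations, so both closures stay inside. Conversely each
  \<open>T \<otimes> B\<close> is itself a generator.\<close>

lemma wot_tensor_singleton:
  fixes t :: "'h::chilbert_space \<Rightarrow> 'k::chilbert_space \<Rightarrow> 'l::chilbert_space"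
  assumes t: "hilbert_tensor t" and T: "T \<in> bounded_ops" and T0: "T \<noteq> 0"
  shows "wot_tensor t (cspan {T}) bounded_ops = tensor_ops t T"
proof
  let ?G = "{tensor_op t A B | A B. A \<in> cspan {T} \<and> B \<in> bounded_ops}"
  have "?G \<subseteq> tensor_ops t T"
  proof
    fix D assume "D \<in> ?G"
    then obtain c B where B: "B \<in> bounded_ops" and D: "D = tensor_op t (c *\<^sub>C T) B"
      by (auto simp: complex_vector.span_singleton)
    have cT: "c *\<^sub>C T \<in> bounded_ops" using T complex_vector.subspace_scale[OF csubspace_bounded_ops] by blast
    \<comment> \<open>The scalar moves from \<open>T\<close> to the right factor.\<close>
    have "D (t x y) = t (T x) ((c *\<^sub>C B) y)" for x y
      using t unfolding D tensor_op_apply[OF t cT B]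
      by (simp add: blinfun_scaleC_apply tensor_scaleC_left tensor_scaleC_right)
    moreover have "c *\<^sub>C B \<in> bounded_ops"
      using B complex_vector.subspace_scale[OF csubspace_bounded_ops] by blast
    ultimately show "D \<in> tensor_ops t T"
      using tensor_op_in[OF t cT B] by (auto simp: tensor_ops_def D)
  qed
  then have "cspan ?G \<subseteq> tensor_ops t T"
    by (rule complex_vector.span_minimal[OF _ csubspace_tensor_ops[OF t]])
  then have sp: "spatial_tensor t (cspan {T}) bounded_ops \<subseteq> tensor_ops t T"
    unfolding spatial_tensor_def by (rule closure_minimal[OF _ closed_tensor_ops[OF assms]])
  show "wot_tensor t (cspan {T}) bounded_ops \<subseteq> tensor_ops t T"
  proof
    fix D assume D: "D \<in> wot_tensor t (cspan {T}) bounded_ops"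
    have "D \<in> bounded_ops"
      using D unfolding wot_tensor_def
      by (simp flip: topspace_wot add: in_closure_of)
    moreover have "cinner (D (t x y)) (t x' y') * cinner (T w) w'
        = cinner (D (t w y)) (t w' y') * cinner (T x) x'" for x x' w w' y y'
    proof -
      let ?f = "\<lambda>D::'l \<Rightarrow>\<^sub>L 'l. cinner (D (t x y)) (t x' y') * cinner (T w) w'"
      let ?g = "\<lambda>D::'l \<Rightarrow>\<^sub>L 'l. cinner (D (t w y)) (t w' y') * cinner (T x) x'"
      have cont: "continuous_map wot euclidean (\<lambda>D::'l \<Rightarrow>\<^sub>L 'l. cinner (D z) z' * c)" for z z' c
        using continuous_map_compose[OF continuous_map_wot_cinner[of z z'], of euclidean "\<lambda>u. u * c"]
        by (simp add: o_def continuous_intros)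
      have "closedin wot {D \<in> topspace wot. ?f D = ?g D}"
        by (intro closedin_continuous_maps_eq[of euclidean] cont) (simp add: Hausdorff_space_euclidean)
      moreover have "spatial_tensor t (cspan {T}) bounded_ops \<subseteq> {D \<in> topspace wot. ?f D = ?g D}"
        using sp unfolding tensor_ops_eq_coefficients[OF assms] topspace_wot
        by (auto dest!: subsetD)
      ultimately have "wot_tensor t (cspan {T}) bounded_ops \<subseteq> {D \<in> topspace wot. ?f D = ?g D}"
        unfolding wot_tensor_def by (intro closure_of_minimal)
      then show ?thesis using D by blast
    qed
    ultimately show "D \<in> tensor_ops t T"
      unfolding tensor_ops_eq_coefficients[OF assms] by blast
  qed
  show "tensor_ops t T \<subseteq> wot_tensor t (cspan {T}) bounded_ops"
  proof
    fix D assume D: "D \<in> tensor_ops t T"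
    then obtain B where B: "B \<in> bounded_ops" "\<And>x y. D (t x y) = t (T x) (B y)"
      by (auto simp: tensor_ops_def)
    have "D = tensor_op t T B"
      using D tensor_op[OF t T B(1)] B(2)
      by (intro bounded_ops_eq_on_tensors[OF t]) (simp_all add: tensor_ops_def)
    then have "D \<in> ?G" using B(1) complex_vector.span_base[of T "{T}"] by blast
    then have "D \<in> spatial_tensor t (cspan {T}) bounded_ops"
      unfolding spatial_tensor_def by (intro subsetD[OF closure_subset] complex_vector.span_base)
    moreover have "D \<in> topspace wot"
      using D unfolding topspace_wot tensor_ops_def by simp
    ultimately show "D \<in> wot_tensor t (cspan {T}) bounded_ops"
      unfolding wot_tensor_def by (intro subsetD[OF closure_of_subset_Int] IntI)
  qed
qed

section \<open>Rank one operators\<close>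

lemma csubspace_orbit:
  assumes "csubspace S"
  shows "csubspace ((\<lambda>B. blinfun_apply B x) ` S)"
proof (rule complex_vector.subspaceI)
  show "0 \<in> (\<lambda>B. blinfun_apply B x) ` S"
    using complex_vector.subspace_0[OF assms] by (intro image_eqI[of _ _ 0]) simp_all
next
  fix y z assume "y \<in> (\<lambda>B. blinfun_apply B x) ` S" "z \<in> (\<lambda>B. blinfun_apply B x) ` S"
  then obtain B C where "B \<in> S" "C \<in> S" "y = B x" "z = C x" by blast
  then show "y + z \<in> (\<lambda>B. blinfun_apply B x) ` S"
    using complex_vector.subspace_add[OF assms]
    by (intro image_eqI[of _ _ "B + C"]) (simp_all add: blinfun.add_left)
next
  fix c y assume "y \<in> (\<lambda>B. blinfun_apply B x) ` S"
  then obtain B where "B \<in> S" "y = B x" by blast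
  then show "c *\<^sub>C y \<in> (\<lambda>B. blinfun_apply B x) ` S"
    using complex_vector.subspace_scale[OF assms]
    by (intro image_eqI[of _ _ "c *\<^sub>C B"]) (simp_all add: blinfun_scaleC_apply)
qed

lemma closure_orbit:
  assumes "csubspace S"
  shows "closed (closure ((\<lambda>B. blinfun_apply B x) ` S))"
    and "csubspace (closure ((\<lambda>B. blinfun_apply B x) ` S))"
  by (simp_all add: csubspace_closure csubspace_orbit assms)

text \<open>Each residual is at most \<open>norm A\<close> because 0 lies in the orbit, so the real
  supremum runs over a bounded set and dominates its members.\<close>

lemma orth_proj_residual_le_beta:
  fixes A :: "'a::chilbert_space \<Rightarrow>\<^sub>L 'a"
  assumes S: "csubspace S" and "norm x = 1"
  shows "norm (A x - orth_proj (closure ((\<lambda>B. blinfun_apply B x) ` S)) (A x)) \<le> beta S A"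
  unfolding beta_def
proof (rule cSUP_upper)
  show "x \<in> {x. norm x = 1}" using assms(2) by simp
  show "bdd_above ((\<lambda>x. norm (A x - orth_proj (closure ((\<lambda>B. blinfun_apply B x) ` S)) (A x)))
      ` {x. norm x = 1})"
  proof (rule bdd_aboveI2)
    fix x :: 'a assume x: "x \<in> {x. norm x = 1}"
    have "norm (A x - orth_proj (closure ((\<lambda>B. blinfun_apply B x) ` S)) (A x)) \<le> norm (A x - 0)"
      by (intro norm_diff_orth_proj_le closure_orbit[OF S]
          complex_vector.subspace_0[OF closure_orbit(2)[OF S]])
    also have "\<dots> \<le> norm A" using norm_blinfun[of A x] x by simp
    finally show "norm (A x - orth_proj (closure ((\<lambda>B. blinfun_apply B x) ` S)) (A x)) \<le> norm A" .
  qed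
qed

text \<open>Transfers bounds from unit vectors, the only ones entering \<open>beta\<close>, to all
  vectors.\<close>

lemma bounded_clinear_sgn:
  assumes "bounded_clinear F"
  shows "norm (F x) = norm (F (sgn x)) * norm x"
proof (cases "x = 0")
  case True
  then show ?thesis by (simp add: bounded_clinear_zero[OF assms])
next
  case False
  have "F (sgn x) = inverse (norm x) *\<^sub>R F x"
    unfolding sgn_div_norm
    by (rule linear_scale[OF bounded_linear.linear[OF bounded_clinear_bounded_linear[OF assms]]])
  then show ?thesis using False by simp
qed

text \<open>\<open>W\<close> inverts \<open>1 - G\<close>: its values are the fixed points of the
  contractions \<open>w \<mapsto> x + G w\<close>, and their uniqueness makes \<open>W\<close>
  linear.\<close>

lemma Neumann_inverse:
  fixes G :: "'a::chilbert_space \<Rightarrow> 'a"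
  assumes G: "bounded_clinear G" and q: "0 \<le> q" "q < 1" and bound: "\<And>x. norm (G x) \<le> q * norm x"
  shows "\<exists>W. bounded_clinear W \<and> (\<forall>x. W x = x + G (W x))"
proof -
  have ex: "\<exists>!w. x + G w = w" for x
  proof (rule banach_fix_type[OF q], intro allI)
    fix w w'
    show "dist (x + G w) (x + G w') \<le> q * dist w w'"
      using bound[of "w - w'"] by (simp add: dist_norm bounded_clinear_diff[OF G])
  qed
  then obtain W where W: "\<And>x. x + G (W x) = W x" by metis
  have uniq: "w = W x" if "x + G w = w" for x w
    using ex W that by metis
  have "bounded_clinear W"
  proof (rule bounded_clinearI[where C = "1 / (1 - q)"])
    show "W (x + y) = W x + W y" for x y
      using W[of x] W[of y] by (intro uniq[symmetric]) (simp add: bounded_clinear_add[OF G] algebra_simps)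
    show "W (c *\<^sub>C x) = c *\<^sub>C W x" for c x
      using W[of x] by (intro uniq[symmetric]) (simp add: bounded_clinear_scaleC[OF G] flip: scaleC_add_right)
    show "norm (W x) \<le> 1 / (1 - q) * norm x" for x
    proof -
      have "norm (W x) \<le> norm x + q * norm (W x)"
        using norm_triangle_ineq[of x "G (W x)"] bound[of "W x"] W[of x] by simp
      then show ?thesis using q by (simp add: field_simps)
    qed
  qed
  then show ?thesis using W by metis
qed

section \<open>Orthogonal projections and Parrott's theorem\<close>

definition orthogonal_projection :: "('a::chilbert_space \<Rightarrow> 'a) \<Rightarrow> bool"
  where "orthogonal_projection P \<longleftrightarrow> bounded_clinear P \<and> (\<forall>x. P (P x) = P x)
    \<and> (\<forall>x y. cinner (P x) y = cinner x (P y))"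

lemma orthogonal_projection_compl:
  "orthogonal_projection P \<Longrightarrow> orthogonal_projection (\<lambda>x. x - P x)"
  by (simp add: orthogonal_projection_def bounded_clinear_minus bounded_clinear_ident
      bounded_clinear_diff cinner_simps)

lemma norm_orthogonal_projection_le:
  assumes "orthogonal_projection P"
  shows "norm (P x) \<le> norm x"
proof -
  have "cinner (P x) (x - P x) = 0"
    using assms by (simp add: orthogonal_projection_def cinner_diff_right)
  then have "(norm (P x + (x - P x)))\<^sup>2 = (norm (P x))\<^sup>2 + (norm (x - P x))\<^sup>2"
    by (subst norm_add_sq) simp
  then have "(norm (P x))\<^sup>2 \<le> (norm x)\<^sup>2" by simp
  then show ?thesis by (rule power2_le_imp_le) simp
qed

text \<open>Parrott's theorem, up to an arbitrarily small loss. Relative to \<open>P\<close> and \<open>Q\<close> the operator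
  \<open>A\<close> is a \<open>2 \<times> 2\<close> block matrix whose corner \<open>P A Q\<close> may be changed freely. With
  \<open>F = (1 - P) A\<close>, the vector \<open>w = Q x + e\<close> is chosen so that \<open>\<gamma>\<^sup>2 e = (1 - Q) F\<^sup>* F w\<close>; then
  \<open>x = w + b\<close> with the new operator sending \<open>w\<close> to \<open>F w\<close> and \<open>b\<close> to \<open>A b\<close>, and the choice of \<open>e\<close>
  makes the cross term \<open>\<langle>F w, A b\<rangle>\<close> equal to \<open>\<gamma>\<^sup>2 \<langle>w, b\<rangle>\<close>.\<close>

lemma Parrott:
  fixes A P Q :: "'a::chilbert_space \<Rightarrow> 'a"
  assumes A: "bounded_clinear A" and P: "orthogonal_projection P" and Q: "orthogonal_projection Q"
    and row: "\<And>x. norm (A x - P (A x)) \<le> \<beta> * norm x"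
    and col: "\<And>x. Q x = 0 \<Longrightarrow> norm (A x) \<le> \<beta> * norm x"
    and "0 \<le> \<beta>" "\<beta> < \<gamma>"
  shows "\<exists>Z. bounded_clinear Z \<and> (\<forall>x. P (Z x) = Z x) \<and> (\<forall>x. Z (Q x) = Z x)
    \<and> (\<forall>x. norm (A x - Z x) \<le> \<gamma> * norm x)"
proof -
  have Pl: "bounded_clinear P" and Ql: "bounded_clinear Q"
    using P Q by (simp_all add: orthogonal_projection_def)
  define F where "F x = A x - P (A x)" for x
  have F: "bounded_clinear F" unfolding F_def
    by (intro bounded_clinear_minus A bounded_clinear_compose[OF Pl])
  have PF: "P (F x) = 0" for x
    using P by (simp add: F_def orthogonal_projection_def bounded_clinear_diff)
  have F_bound: "norm (F x) \<le> \<beta> * norm x" for x unfolding F_def by (rule row)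
  define H where "H x = cadj F (F x)" for x
  have H: "bounded_clinear H" unfolding H_def
    by (rule bounded_clinear_compose[OF bounded_clinear_cadj[OF F] F])
  have H_bound: "norm (H x) \<le> \<beta>\<^sup>2 * norm x" for x
  proof -
    have "norm (H x) \<le> \<beta> * norm (F x)"
      unfolding H_def by (rule norm_cadj_le[OF F \<open>0 \<le> \<beta>\<close> F_bound])
    also have "\<dots> \<le> \<beta> * (\<beta> * norm x)" by (intro mult_left_mono F_bound \<open>0 \<le> \<beta>\<close>)
    finally show ?thesis by (simp add: power2_eq_square mult.assoc)
  qed
  \<comment> \<open>With this \<open>G\<close>, the requirement on \<open>e\<close> becomes the
    linear equation \<open>w = Q x + G w\<close>.\<close>
  define G where "G x = complex_of_real (1 / \<gamma>\<^sup>2) *\<^sub>C (H x - Q (H x))" for x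
  have G: "bounded_clinear G" unfolding G_def
    by (intro bounded_clinear_scaleC_comp bounded_clinear_minus H bounded_clinear_compose[OF Ql])
  have "0 < \<gamma>" using assms by simp
  have QG: "Q (G x) = 0" for x
    using Q by (simp add: G_def orthogonal_projection_def bounded_clinear_diff bounded_clinear_scaleC)
  \<comment> \<open>The strict inequality \<open>\<beta> < \<gamma>\<close> enters here: it makes
    \<open>G\<close> a contraction.\<close>
  have "\<exists>W. bounded_clinear W \<and> (\<forall>x. W x = x + G (W x))"
  proof (rule Neumann_inverse[OF G, where q = "\<beta>\<^sup>2 / \<gamma>\<^sup>2"])
    show "\<beta>\<^sup>2 / \<gamma>\<^sup>2 < 1"
      using \<open>0 < \<gamma>\<close> assms(6,7) by (simp add: power_strict_mono)
    show "norm (G x) \<le> \<beta>\<^sup>2 / \<gamma>\<^sup>2 * norm x" for x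
    proof -
      have "norm (H x - Q (H x)) \<le> \<beta>\<^sup>2 * norm x"
        using norm_orthogonal_projection_le[OF orthogonal_projection_compl[OF Q], of "H x"] H_bound[of x]
        by linarith
      then have "1 / \<gamma>\<^sup>2 * norm (H x - Q (H x)) \<le> 1 / \<gamma>\<^sup>2 * (\<beta>\<^sup>2 * norm x)"
        by (rule mult_left_mono) simp
      then show ?thesis by (simp add: G_def norm_scaleC norm_divide norm_power)
    qed
  qed simp
  then obtain W where W: "bounded_clinear W" "\<And>x. W x = x + G (W x)" by blast
  define Z where "Z x = P (A (W (Q x)))" for x
  have "norm (A x - Z x) \<le> \<gamma> * norm x" for x
  proof -
    define w where "w = W (Q x)"
    define b where "b = x - w"
    have w: "w = Q x + G w" unfolding w_def by (rule W(2))
    have x: "x = w + b" by (simp add: b_def)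
    have Qb: "Q b = 0"
    proof -
      have "Q w = Q (Q x) + Q (G w)" by (subst w) (rule bounded_clinear_add[OF Ql])
      then have "Q w = Q x" using Q by (simp add: QG orthogonal_projection_def)
      then show ?thesis by (simp add: b_def bounded_clinear_diff[OF Ql])
    qed
    \<comment> \<open>\<open>P\<close> kills \<open>F w\<close>, so \<open>A b\<close> may be
      replaced by \<open>F b\<close> in the cross term.\<close>
    have "cinner (F w) (P (A b)) = 0"
      using P PF by (metis cinner_zero_left orthogonal_projection_def)
    then have "cinner (F w) (A b) = cinner (F w) (F b)"
      by (simp add: F_def[of b] cinner_diff_right)
    also have "\<dots> = cinner (H w) b"
      by (simp add: H_def cinner_cadj_left[OF F])
    also have "\<dots> = cinner (H w - Q (H w)) b"
      using Q Qb by (simp add: cinner_diff_left orthogonal_projection_def)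
    also have "H w - Q (H w) = complex_of_real (\<gamma>\<^sup>2) *\<^sub>C G w"
      using \<open>0 < \<gamma>\<close> by (simp add: G_def scaleC_scaleC del: of_real_power)
    also have "cinner (complex_of_real (\<gamma>\<^sup>2) *\<^sub>C G w) b = complex_of_real (\<gamma>\<^sup>2) * cinner w b"
    proof -
      have "cinner (Q x) b = 0" using Q Qb by (simp add: orthogonal_projection_def)
      then have "cinner w b = cinner (G w) b" by (subst w) (simp add: cinner_add_left)
      then show ?thesis by (simp add: cinner_scaleC_left)
    qed
    finally have cross: "Re (cinner (F w) (A b)) = \<gamma>\<^sup>2 * Re (cinner w b)"
      by (simp del: of_real_power)
    have "A x - Z x = F w + A b"
      unfolding Z_def F_def w_def[symmetric] by (subst x) (simp add: bounded_clinear_add[OF A])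
    then have "(norm (A x - Z x))\<^sup>2 = (norm (F w))\<^sup>2 + (norm (A b))\<^sup>2 + 2 * (\<gamma>\<^sup>2 * Re (cinner w b))"
      by (simp add: norm_add_sq cross)
    moreover have "(norm (F w))\<^sup>2 \<le> (\<gamma> * norm w)\<^sup>2"
      using F_bound[of w] mult_right_mono[of \<beta> \<gamma> "norm w"] assms(7) by (intro power_mono) auto
    moreover have "(norm (A b))\<^sup>2 \<le> (\<gamma> * norm b)\<^sup>2"
      using col[OF Qb] mult_right_mono[of \<beta> \<gamma> "norm b"] assms(7) by (intro power_mono) auto
    moreover have "(\<gamma> * norm x)\<^sup>2 = (\<gamma> * norm w)\<^sup>2 + (\<gamma> * norm b)\<^sup>2 + 2 * (\<gamma>\<^sup>2 * Re (cinner w b))"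
      by (subst x) (simp add: power_mult_distrib norm_add_sq distrib_left)
    ultimately have "(norm (A x - Z x))\<^sup>2 \<le> (\<gamma> * norm x)\<^sup>2" by linarith
    then show ?thesis by (rule power2_le_imp_le) (use \<open>0 < \<gamma>\<close> in simp)
  qed
  moreover have "bounded_clinear Z" unfolding Z_def
    by (intro bounded_clinear_compose[OF Pl] bounded_clinear_compose[OF A]
        bounded_clinear_compose[OF W(1)] Ql)
  moreover have "P (Z x) = Z x" "Z (Q x) = Z x" for x
    using P Q by (simp_all add: Z_def orthogonal_projection_def)
  ultimately show ?thesis by blast
qed

text \<open>For a unit vector \<open>u\<close> the map \<open>t u\<close> is an isometry, so
  composing it with its adjoint projects onto \<open>u \<otimes> K\<close>.\<close>

lemma orthogonal_projection_tensor:
  assumes t: "hilbert_tensor t" and u: "norm u = 1"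
  shows "orthogonal_projection (\<lambda>z. t u (cadj (t u) z))"
proof -
  note tu = bounded_clinear_tensor_right[OF t, of u]
  have "cinner u u = 1" using u by (simp add: cinner_self)
  then show ?thesis
    unfolding orthogonal_projection_def
    by (auto simp: bounded_clinear_compose[OF tu bounded_clinear_cadj[OF tu]] cadj_tensor_right[OF t]
        cinner_cadj_right[OF tu, symmetric] cinner_cadj_left[OF tu, symmetric])
qed

lemma hyperreflexive_with_1_tensor_ops:
  fixes t :: "'h::chilbert_space \<Rightarrow> 'k::chilbert_space \<Rightarrow> 'l::chilbert_space" and T :: "'h \<Rightarrow>\<^sub>L 'h"
  assumes t: "hilbert_tensor t" and Tv: "\<And>x. T x = cinner x v *\<^sub>C u"
    and u: "norm u = 1" and "v \<noteq> 0" and "(k :: 'k) \<noteq> 0"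
  shows "hyperreflexive_with 1 (tensor_ops t T)"
  unfolding hyperreflexive_with_def
proof
  fix A :: "'l \<Rightarrow>\<^sub>L 'l" assume "A \<in> bounded_ops"
  then have A: "bounded_clinear (blinfun_apply A)" by (simp add: bounded_ops_iff)
  let ?S = "tensor_ops t T"
  let ?M = "\<lambda>x. closure ((\<lambda>B. blinfun_apply B x) ` ?S)"
  have S: "csubspace ?S" by (rule csubspace_tensor_ops[OF t])
  note tl = bounded_clinear_tensor_right[OF t]
  define \<nu> where "\<nu> = complex_of_real (norm v)"
  define v' where "v' = inverse \<nu> *\<^sub>C v"
  have \<nu>0: "\<nu> \<noteq> 0" using \<open>v \<noteq> 0\<close> by (simp add: \<nu>_def)
  have v': "norm v' = 1" using \<open>v \<noteq> 0\<close> by (simp add: v'_def norm_scaleC \<nu>_def norm_inverse)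
  have Tv': "T x = (\<nu> * cinner x v') *\<^sub>C u" for x
    using \<nu>0 by (simp add: Tv v'_def cinner_scaleC_right) (simp add: \<nu>_def)
  define P where "P z = t u (cadj (t u) z)" for z
  define Q where "Q z = t v' (cadj (t v') z)" for z
  have P: "orthogonal_projection P" and Q: "orthogonal_projection Q"
    unfolding P_def Q_def using orthogonal_projection_tensor[OF t] u v' by blast+
  then have Pl: "bounded_clinear P" and Ql: "bounded_clinear Q"
    by (simp_all add: orthogonal_projection_def)
  have PQ: "P (D z) = D z \<and> D (Q z) = D z" if D: "D \<in> ?S" for D z
  proof -
    from D obtain B where Dl: "bounded_clinear (blinfun_apply D)" and B: "bounded_clinear (blinfun_apply B)"
      and DB: "\<And>x y. D (t x y) = t (T x) (B y)"
      by (auto simp: tensor_ops_def bounded_ops_iff)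
    have uu: "cinner u u = 1" "cinner v' v' = 1" using u v' by (simp_all add: cinner_self)
    have "P (D z) = D z"
    proof (rule bounded_clinear_eq_on_tensors[OF t bounded_clinear_compose[OF Pl Dl] Dl])
      show "P (D (t x y)) = D (t x y)" for x y
        by (simp add: DB P_def Tv cadj_tensor_right[OF t] uu
            bounded_clinear_scaleC[OF bounded_clinear_cadj[OF tl]]
            tensor_scaleC_left[OF t] tensor_scaleC_right[OF t])
    qed
    moreover have "D (Q z) = D z"
    proof (rule bounded_clinear_eq_on_tensors[OF t bounded_clinear_compose[OF Dl Ql] Dl])
      show "D (Q (t x y)) = D (t x y)" for x y
        by (simp add: Q_def DB Tv' cadj_tensor_right[OF t] uu bounded_clinear_scaleC[OF Dl]
            tensor_scaleC_left[OF t] tensor_scaleC_right[OF t] scaleC_scaleC mult.commute)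
    qed
    ultimately show ?thesis by blast
  qed
  define \<beta> where "\<beta> = beta ?S A"
  have \<beta>: "norm (A x - orth_proj (?M x) (A x)) \<le> \<beta>" if "norm x = 1" for x
    unfolding \<beta>_def by (rule orth_proj_residual_le_beta[OF S that])
  have proj_in: "orth_proj (?M x) y \<in> ?M x" for x y
    by (rule orth_proj_in[OF closure_orbit[OF S]])
  \<comment> \<open>\<open>k\<close> supplies a unit vector of the tensor product, whose residual
    shows \<open>0 \<le> \<beta>\<close>.\<close>
  have "t u k \<noteq> 0" using norm_tensor[OF t, of u k] u \<open>k \<noteq> 0\<close> by auto
  then have "norm (sgn (t u k)) = 1" by (simp add: norm_sgn)
  then have "0 \<le> \<beta>" using \<beta> norm_ge_zero order_trans by blast
  have row: "norm (A x - P (A x)) \<le> \<beta> * norm x" for x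
  proof (cases "x = 0")
    case True
    then show ?thesis by (simp add: bounded_clinear_zero[OF Pl])
  next
    case False
    define e where "e = sgn x"
    define p where "p = orth_proj (?M e) (A e)"
    have e: "norm e = 1" using False by (simp add: e_def norm_sgn)
    have "closed {z. P z = z}"
      by (intro closed_Collect_eq continuous_on_bounded_clinear[OF Pl] continuous_intros)
    then have "?M e \<subseteq> {z. P z = z}"
      using PQ by (intro closure_minimal) auto
    then have "P p = p" using proj_in[of e "A e"] by (auto simp: p_def)
    \<comment> \<open>The orbit closure lies in the range of \<open>P\<close>, so
      \<open>1 - P\<close> sees only the residual \<open>A e - p\<close>.\<close>
    then have "A e - P (A e) = (A e - p) - P (A e - p)"
      by (simp add: bounded_clinear_diff[OF Pl])
    then have "norm (A e - P (A e)) \<le> norm (A e - p)"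
      using norm_orthogonal_projection_le[OF orthogonal_projection_compl[OF P], of "A e - p"]
      by (simp only:)
    also have "\<dots> \<le> \<beta>" unfolding p_def by (rule \<beta>[OF e])
    finally have "norm (A e - P (A e)) * norm x \<le> \<beta> * norm x" by (rule mult_right_mono) simp
    then show ?thesis
      using bounded_clinear_sgn[OF bounded_clinear_minus[OF A bounded_clinear_compose[OF Pl A]], of x]
      by (simp add: e_def)
  qed
  have col: "norm (A x) \<le> \<beta> * norm x" if Qx: "Q x = 0" for x
  proof (cases "x = 0")
    case False
    define e where "e = sgn x"
    have e: "norm e = 1" using False by (simp add: e_def norm_sgn)
    have "norm (Q x) = norm (Q e) * norm x" unfolding e_def by (rule bounded_clinear_sgn[OF Ql])
    then have "Q e = 0" using Qx False by simp
    \<comment> \<open>Every \<open>D\<close> factors through \<open>Q\<close> and hence kills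
      \<open>e\<close>; the orbit is zero and the residual is \<open>A e\<close> itself.\<close>
    then have "D e = 0" if "D \<in> ?S" for D
      using PQ[OF that, of e] by (simp add: blinfun.zero_right)
    then have "?M e \<subseteq> {0}" by (intro closure_minimal) auto
    then have "orth_proj (?M e) (A e) = 0" using proj_in[of e "A e"] by auto
    then have "norm (A e) \<le> \<beta>" using \<beta>[OF e] by simp
    then have "norm (A e) * norm x \<le> \<beta> * norm x" by (rule mult_right_mono) simp
    then show ?thesis using bounded_clinear_sgn[OF A, of x] by (simp add: e_def)
  qed simp
  have "infdist A ?S \<le> \<gamma>" if \<gamma>: "\<beta> < \<gamma>" for \<gamma>
  proof -
    obtain Z where Z: "bounded_clinear Z" "\<And>x. P (Z x) = Z x" "\<And>x. Z (Q x) = Z x"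
      "\<And>x. norm (A x - Z x) \<le> \<gamma> * norm x"
      using Parrott[OF A P Q row col \<open>0 \<le> \<beta>\<close> \<gamma>] by blast
    \<comment> \<open>Since \<open>Z = P Z Q\<close>, it is determined by slicing
      \<open>Z (v' \<otimes> y)\<close> along \<open>u\<close>; the factor
      \<open>inverse \<nu>\<close> compensates for \<open>T v' = \<nu> u\<close>.\<close>
    define B where "B y = inverse \<nu> *\<^sub>C cadj (t u) (Z (t v' y))" for y
    have B: "bounded_clinear B" unfolding B_def
      by (intro bounded_clinear_scaleC_comp bounded_clinear_compose[OF bounded_clinear_cadj[OF tl]]
          bounded_clinear_compose[OF Z(1) tl])
    have "Z (t x y) = t (T x) (B y)" for x y
    proof -
      have "Z (t x y) = Z (t v' (cinner x v' *\<^sub>C y))"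
        by (subst Z(3)[symmetric]) (simp add: Q_def cadj_tensor_right[OF t])
      also have "\<dots> = cinner x v' *\<^sub>C P (Z (t v' y))"
        by (simp add: Z(2) tensor_scaleC_right[OF t] bounded_clinear_scaleC[OF Z(1)])
      also have "\<dots> = t (T x) (B y)"
        using \<nu>0 by (simp add: P_def B_def Tv' tensor_scaleC_left[OF t] tensor_scaleC_right[OF t]
            scaleC_scaleC)
      finally show ?thesis .
    qed
    then have "Blinfun Z \<in> ?S"
      unfolding tensor_ops_def using bounded_clinear_Blinfun[OF B] bounded_clinear_Blinfun[OF Z(1)]
      by (intro CollectI conjI bexI[of _ "Blinfun B"]) simp_all
    then have "infdist A ?S \<le> dist A (Blinfun Z)" by (rule infdist_le)
    also have "\<dots> \<le> \<gamma>"
      unfolding dist_norm using \<open>0 \<le> \<beta>\<close> \<gamma> Z(4)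
      by (intro norm_blinfun_bound) (simp_all add: blinfun.diff_left bounded_clinear_Blinfun[OF Z(1)])
    finally show ?thesis .
  qed
  \<comment> \<open>The loss in Parrott's theorem disappears because \<open>\<gamma>\<close> may be
    any number above \<open>\<beta>\<close>.\<close>
  then show "infdist A ?S \<le> 1 * beta ?S A"
    unfolding \<beta>_def[symmetric] mult_1 by (rule dense_ge)
qed

section \<open>Operators of higher rank\<close>

lemma crank_eq_1_imp_range:
  assumes "crank T = 1"
  shows "\<exists>u. range (blinfun_apply T) \<subseteq> cspan {u}"
proof -
  have "cdim_nat (range (blinfun_apply T)) = 1"
    using assms by (auto simp: crank_def cdim_def one_enat_def split: if_splits)
  then obtain B where "range (blinfun_apply T) \<subseteq> cspan B" "card B = 1"
    using complex_vector.basis_exists[of "range (blinfun_apply T)"] by metis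
  then show ?thesis by (auto simp: card_1_singleton_iff)
qed

lemma range_imp_crank_eq_1:
  fixes T :: "'a::chilbert_space \<Rightarrow>\<^sub>L 'a"
  assumes "T h \<noteq> 0" and "range (blinfun_apply T) \<subseteq> cspan {T h}"
  shows "crank T = 1"
proof -
  have "cdim_nat (range (blinfun_apply T)) = 1"
    by (rule complex_vector.dim_unique[of "{T h}"]) (use assms in auto)
  then show ?thesis
    using assms(2) by (auto simp: crank_def cdim_def one_enat_def intro: exI[of _ "{T h}"])
qed

text \<open>One Gram-Schmidt step, with \<open>d\<close> the length of the orthogonal part. It
  supplies the second vector in each of the pairs in \<open>K\<close>, in the domain of
  \<open>T\<close> and in its range.\<close>

lemma orthogonal_decomposition:
  fixes e g :: "'a::chilbert_space"
  assumes "norm e = 1" and "g \<notin> cspan {e}"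
  obtains e' c d where "norm e' = 1" "cinner e e' = 0" "0 < d" "g = c *\<^sub>C e + complex_of_real d *\<^sub>C e'"
proof -
  define c where "c = cinner g e"
  define z where "z = g - c *\<^sub>C e"
  have "z \<noteq> 0" using assms(2) by (auto simp: z_def complex_vector.span_singleton)
  have "cinner z e = 0"
    using assms(1) by (simp add: z_def cinner_simps cinner_self c_def)
  then have "cinner e z = 0" by (subst cinner_commute) simp
  with \<open>z \<noteq> 0\<close> show thesis
    by (intro that[of "complex_of_real (inverse (norm z)) *\<^sub>C z" "norm z" c])
      (simp_all add: norm_scaleC norm_inverse cinner_scaleC_right scaleC_scaleC z_def flip: of_real_mult)
qed

lemma orthonormal_pair_exists:
  assumes "cdim (UNIV :: 'k::chilbert_space set) = \<infinity>"
  obtains f1 f2 :: "'k::chilbert_space" where "norm f1 = 1" "norm f2 = 1" "cinner f1 f2 = 0"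
proof -
  have inf: "\<not> UNIV \<subseteq> cspan B" if "finite B" for B :: "'k set"
    using assms that by (auto simp: cdim_def split: if_splits)
  obtain x :: 'k where "x \<noteq> 0" using inf[of "{}"] by auto
  define f1 where "f1 = sgn x"
  have f1: "norm f1 = 1" using \<open>x \<noteq> 0\<close> by (simp add: f1_def norm_sgn)
  obtain g where "g \<notin> cspan {f1}" using inf[of "{f1}"] by auto
  from orthogonal_decomposition[OF f1 this] show thesis using f1 that by metis
qed

text \<open>From the span of \<open>h1\<close>, \<open>h2\<close> to that of \<open>k1\<close>,
  \<open>k2\<close> the operator is upper triangular with positive diagonal entries
  \<open>\<alpha>\<close>, \<open>\<gamma>\<close> and arbitrary off-diagonal entry
  \<open>\<beta>\<close>.\<close>

locale tensor_witness =
  fixes t :: "'h::chilbert_space \<Rightarrow> 'k::chilbert_space \<Rightarrow> 'l::chilbert_space" and T :: "'h \<Rightarrow>\<^sub>L 'h"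
    and h1 h2 k1 k2 :: 'h and f1 f2 :: 'k and \<alpha> \<gamma> :: real and \<beta> :: complex
  assumes t: "hilbert_tensor t" and T: "T \<in> bounded_ops"
    and h: "norm h1 = 1" "norm h2 = 1" "cinner h1 h2 = 0"
    and k: "norm k1 = 1" "norm k2 = 1" "cinner k1 k2 = 0"
    and f: "norm f1 = 1" "norm f2 = 1" "cinner f1 f2 = 0"
    and \<alpha>: "0 < \<alpha>" and \<gamma>: "0 < \<gamma>"
    and Th1: "T h1 = complex_of_real \<alpha> *\<^sub>C k1"
    and Th2: "T h2 = \<beta> *\<^sub>C k1 + complex_of_real \<gamma> *\<^sub>C k2"
begin

lemma orthonormal:
  "cinner h1 h1 = 1" "cinner h2 h2 = 1" "cinner h1 h2 = 0" "cinner h2 h1 = 0"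
  "cinner k1 k1 = 1" "cinner k2 k2 = 1" "cinner k1 k2 = 0" "cinner k2 k1 = 0"
  "cinner f1 f1 = 1" "cinner f2 f2 = 1" "cinner f1 f2 = 0" "cinner f2 f1 = 0"
  using h k f by (simp_all add: cinner_self cinner_commute[of h2 h1] cinner_commute[of k2 k1]
      cinner_commute[of f2 f1])

lemma T_linear: "bounded_clinear (blinfun_apply T)"
  using T by (simp add: bounded_ops_iff)

section \<open>The witness operator and its distance to the space\<close>

definition s :: complex where "s = complex_of_real (1 / sqrt 2)"

definition y1 :: 'l where "y1 = s *\<^sub>C (t k1 f1 + t k2 f2)"

definition y2 :: 'l where "y2 = - t k2 f1"

definition A :: "'l \<Rightarrow>\<^sub>L 'l"
  where "A = Blinfun (\<lambda>z. cinner z (t h1 f1) *\<^sub>C y1 + cinner z (t h2 f1) *\<^sub>C y2)"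

lemma A_in: "A \<in> bounded_ops"
  and A_apply: "A z = cinner z (t h1 f1) *\<^sub>C y1 + cinner z (t h2 f1) *\<^sub>C y2"
  unfolding A_def
  by (simp_all add: bounded_clinear_Blinfun bounded_clinear_plus bounded_clinear_cinner_scaleC)

lemma cnj_s: "cnj s = s" and s_sq: "s * s = 1 / 2" and s_nz: "s \<noteq> 0"
  by (simp_all add: s_def flip: of_real_mult)

lemma y_orthonormal: "cinner y1 y1 = 1" "cinner y2 y2 = 1" "cinner y1 y2 = 0"
  using s_sq by (simp_all add: y1_def y2_def cinner_simps cinner_tensor[OF t] orthonormal cnj_s
      mult_ac)

lemma norm_y: "norm y1 = 1" "norm y2 = 1"
  using y_orthonormal(1,2) by (simp_all add: cinner_self power2_eq_1_iff flip: of_real_power)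
    (smt (verit) norm_ge_zero)+

text \<open>For \<open>D = T \<otimes> B\<close> and \<open>c = \<langle>B f1, f1\<rangle>\<close>,
  two coefficients of \<open>A - D\<close> at unit vectors are
  \<open>1 - \<alpha> c / \<surd>2\<close> and \<open>1 + \<gamma> c\<close>. Whatever the sign of
  \<open>Re c\<close>, one of them has real part at least 1.\<close>

lemma one_le_infdist: "1 \<le> infdist A (tensor_ops t T)"
proof -
  have "1 \<le> dist A D" if D: "D \<in> tensor_ops t T" for D
  proof -
    obtain B where B: "\<And>x y. D (t x y) = t (T x) (B y)"
      using D unfolding tensor_ops_def by blast
    define c where "c = cinner (B f1) f1"
    have lower: "Re (cinner ((A - D) x) y) \<le> dist A D" if "norm x = 1" "norm y = 1" for x y
    proof -
      have "Re (cinner ((A - D) x) y) \<le> norm ((A - D) x) * norm y"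
        using complex_Re_le_cmod cinner_Cauchy_Schwarz order_trans by blast
      also have "\<dots> \<le> norm (A - D)" using norm_blinfun[of "A - D" x] that by simp
      finally show ?thesis by (simp add: dist_norm)
    qed
    have n: "norm (t h1 f1) = 1" "norm (t h2 f1) = 1"
      by (simp_all add: norm_tensor[OF t] h f)
    have "cinner ((A - D) (t h1 f1)) y1 = 1 - s * complex_of_real \<alpha> * c"
      by (simp add: blinfun.diff_left A_apply B Th1 cinner_simps cinner_tensor[OF t] orthonormal
          y_orthonormal) (simp add: y1_def cinner_simps cinner_tensor[OF t] orthonormal cnj_s c_def)
    then have "1 - 1 / sqrt 2 * \<alpha> * Re c \<le> dist A D"
      using lower[OF n(1) norm_y(1)] by (simp add: s_def flip: of_real_mult)
    moreover have "cinner ((A - D) (t h2 f1)) y2 = 1 + complex_of_real \<gamma> * c"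
      by (simp add: blinfun.diff_left A_apply B Th2 cinner_simps cinner_tensor[OF t] orthonormal
          y_orthonormal) (simp add: y2_def cinner_simps cinner_tensor[OF t] orthonormal c_def)
    then have "1 + \<gamma> * Re c \<le> dist A D"
      using lower[OF n(2) norm_y(2)] by simp
    moreover have "0 \<le> \<gamma> * Re c \<or> 1 / sqrt 2 * \<alpha> * Re c \<le> 0"
      using \<alpha> \<gamma> by (cases "0 \<le> Re c") (simp_all add: mult_nonneg_nonpos divide_le_0_iff)
    ultimately show ?thesis by linarith
  qed
  moreover have "tensor_ops t T \<noteq> {}"
    using complex_vector.subspace_0[OF csubspace_tensor_ops[OF t]] by blast
  ultimately show ?thesis
    by (simp add: infdist_notempty cINF_greatest)
qed

section \<open>Bounding \<open>beta\<close> through the two coordinates of a vector\<close>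

definition m1 :: "complex \<times> complex \<Rightarrow> complex"
  where "m1 p = fst p * s * cnj (fst p * complex_of_real \<alpha> + snd p * \<beta>)
    - snd p * cnj (snd p) * complex_of_real \<gamma>"

definition m2 :: "complex \<times> complex \<Rightarrow> complex"
  where "m2 p = fst p * s * cnj (snd p) * complex_of_real \<gamma>"

definition \<tau> :: real where "\<tau> = norm T + 1"

text \<open>What remains of the larger coefficient after the worst possible error; truncation at 0
  makes squaring monotone. For \<open>norm p = 1\<close> the error term vanishes.\<close>

definition gap :: "complex \<times> complex \<Rightarrow> real"
  where "gap p = max 0 (max (cmod (m1 p)) (cmod (m2 p)) - \<tau> * sqrt (1 - (norm p)\<^sup>2))"

lemma \<tau>_pos: "0 < \<tau>"
  by (simp add: \<tau>_def add_nonneg_pos)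

text \<open>The vectors \<open>T w \<otimes> f1\<close> and \<open>T w \<otimes> f2\<close>, where \<open>w\<close> is the \<open>f1\<close>-slice of \<open>x\<close>, lie in the
  orbit of \<open>x\<close>. Up to an error controlled by \<open>1 - |a|\<^sup>2 - |b|\<^sup>2\<close>, the inner products of \<open>A x\<close> with
  them are \<open>m1 (a, b)\<close> and \<open>m2 (a, b)\<close>.\<close>

lemma residual_le:
  assumes x: "norm x = 1"
  defines "p \<equiv> (cinner x (t h1 f1), cinner x (t h2 f1))"
  shows "norm p \<le> 1"
    and "(norm (A x - orth_proj (closure ((\<lambda>B. blinfun_apply B x) ` tensor_ops t T)) (A x)))\<^sup>2
      \<le> (norm p)\<^sup>2 - (gap p)\<^sup>2 / \<tau>\<^sup>2"
proof -
  let ?M = "closure ((\<lambda>B. blinfun_apply B x) ` tensor_ops t T)"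
  define a b where "a = cinner x (t h1 f1)" and "b = cinner x (t h2 f1)"
  have p: "p = (a, b)" by (simp add: p_def a_def b_def)
  note sl = bounded_clinear_tensor_left[OF t, of f1]
  \<comment> \<open>Slicing against the unit vector \<open>f1\<close> is a contraction, and the
    coordinates of the slice along \<open>h1\<close>, \<open>h2\<close> are \<open>a\<close>,
    \<open>b\<close>.\<close>
  define w where "w = cadj (\<lambda>h. t h f1) x"
  have "norm w \<le> 1 * norm x"
    unfolding w_def by (rule norm_cadj_le[OF sl]) (simp_all add: norm_tensor[OF t] f)
  then have w: "norm w \<le> 1" using x by simp
  have wh: "cinner w h1 = a" "cinner w h2 = b"
    by (simp_all add: w_def a_def b_def cinner_cadj_left[OF sl])
  define w0 where "w0 = a *\<^sub>C h1 + b *\<^sub>C h2"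
  \<comment> \<open>The part of \<open>w\<close> orthogonal to \<open>h1\<close> and
    \<open>h2\<close>; Pythagoras and \<open>norm w \<le> 1\<close> bound its squared norm by
    \<open>1 - (norm p)\<^sup>2\<close>.\<close>
  define w' where "w' = w - w0"
  have np: "(norm p)\<^sup>2 = (cmod a)\<^sup>2 + (cmod b)\<^sup>2"
    by (simp add: p norm_Pair)
  have "complex_of_real ((norm w0)\<^sup>2) = complex_of_real ((norm p)\<^sup>2)"
    unfolding np cinner_self[symmetric]
    by (simp add: w0_def cinner_simps orthonormal complex_norm_square mult.commute del: of_real_power)
  then have w0: "(norm w0)\<^sup>2 = (norm p)\<^sup>2" by (simp only: of_real_eq_iff)
  have "cinner w' w0 = 0"
    by (simp add: w'_def w0_def cinner_simps orthonormal wh)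
  then have "(norm (w' + w0))\<^sup>2 = (norm w')\<^sup>2 + (norm w0)\<^sup>2" by (simp add: norm_add_sq)
  then have nw: "(norm w')\<^sup>2 + (norm p)\<^sup>2 = (norm w)\<^sup>2" using w0 by (simp add: w'_def)
  moreover have "(norm w)\<^sup>2 \<le> 1" using w by (simp add: power_le_one)
  ultimately have w'1: "(norm w')\<^sup>2 \<le> 1 - (norm p)\<^sup>2" by simp
  then have "(norm p)\<^sup>2 \<le> 1\<^sup>2" using zero_le_power2[of "norm w'"] unfolding one_power2 by linarith
  then show p1: "norm p \<le> 1" by (rule power2_le_imp_le) simp
  have Ax: "A x = a *\<^sub>C y1 + b *\<^sub>C y2" by (simp add: A_apply a_def b_def)
  have "complex_of_real ((norm (A x))\<^sup>2) = complex_of_real ((norm p)\<^sup>2)"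
    unfolding np cinner_self[symmetric] Ax
    using cinner_commute[of y2 y1]
    by (simp add: cinner_simps y_orthonormal complex_norm_square mult.commute del: of_real_power)
  then have nA2: "(norm (A x))\<^sup>2 = (norm p)\<^sup>2" by (simp only: of_real_eq_iff)
  then have nA: "norm (A x) \<le> 1" using p1 by (simp add: power2_eq_iff_nonneg)
  have bound: "(norm (A x - orth_proj ?M (A x)))\<^sup>2
      \<le> (norm p)\<^sup>2 - (max 0 (cmod m - \<tau> * sqrt (1 - (norm p)\<^sup>2)))\<^sup>2 / \<tau>\<^sup>2"
    if g: "norm g = 1" and m: "m = cinner (A x) (t (T w0) g)" for g m
  proof -
    define v where "v = t (T w) g"
    \<comment> \<open>This is \<open>T \<otimes> B\<close> for the rank one
      \<open>B y = \<langle>y, f1\<rangle> g\<close>, and it sends \<open>x\<close> to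
      \<open>v\<close>.\<close>
    define D where "D z = t (T (cadj (\<lambda>h. t h f1) z)) g" for z
    have D: "bounded_clinear D" unfolding D_def
      by (intro bounded_clinear_compose[OF bounded_clinear_tensor_left[OF t]]
          bounded_clinear_compose[OF T_linear] bounded_clinear_cadj sl)
    have B: "bounded_clinear (\<lambda>y. cinner y f1 *\<^sub>C g)" by (rule bounded_clinear_cinner_scaleC)
    have "Blinfun D \<in> tensor_ops t T"
      unfolding tensor_ops_def
      by (intro CollectI conjI bexI[of _ "Blinfun (\<lambda>y. cinner y f1 *\<^sub>C g)"] allI)
        (simp_all add: bounded_clinear_Blinfun[OF D] bounded_clinear_Blinfun[OF B] D_def
          cadj_tensor_left[OF t] bounded_clinear_scaleC[OF T_linear]
          tensor_scaleC_left[OF t] tensor_scaleC_right[OF t])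
    moreover have "v = Blinfun D x"
      by (simp add: bounded_clinear_Blinfun[OF D] D_def v_def w_def)
    ultimately have vM: "v \<in> ?M" by (intro subsetD[OF closure_subset]) (rule image_eqI)
    have normT: "norm (T z) \<le> \<tau> * norm z" for z
      using norm_blinfun[of T z] by (simp add: \<tau>_def distrib_right add_increasing2)
    have "norm v \<le> \<tau> * 1"
      unfolding v_def norm_tensor[OF t] g mult_1_right
      using normT[of w] mult_left_mono[OF w, of \<tau>] \<tau>_pos by linarith
    then obtain c where c: "(norm (A x - c *\<^sub>C v))\<^sup>2 \<le> (norm (A x))\<^sup>2 - (cmod (cinner (A x) v))\<^sup>2 / \<tau>\<^sup>2"
      using exists_scaleC_reducing_norm[of v \<tau> "A x"] \<tau>_pos by auto
    note M = closure_orbit[OF csubspace_tensor_ops[OF t], of x T]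
    have "norm (A x - orth_proj ?M (A x)) \<le> norm (A x - c *\<^sub>C v)"
      by (intro norm_diff_orth_proj_le M complex_vector.subspace_scale vM)
    then have "(norm (A x - orth_proj ?M (A x)))\<^sup>2 \<le> (norm (A x - c *\<^sub>C v))\<^sup>2"
      by (intro power_mono) auto
    with c nA2 have le: "(norm (A x - orth_proj ?M (A x)))\<^sup>2 \<le> (norm p)\<^sup>2 - (cmod (cinner (A x) v))\<^sup>2 / \<tau>\<^sup>2"
      by linarith
    have "w = w0 + w'" by (simp add: w'_def)
    then have "cinner (A x) v = m + cinner (A x) (t (T w') g)"
      by (simp add: v_def m bounded_clinear_add[OF T_linear] tensor_add_left[OF t] cinner_add_right)
    moreover have "cmod (cinner (A x) (t (T w') g)) \<le> \<tau> * sqrt (1 - (norm p)\<^sup>2)"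
    proof -
      have "cmod (cinner (A x) (t (T w') g)) \<le> norm (A x) * norm (t (T w') g)"
        by (rule cinner_Cauchy_Schwarz)
      also have "\<dots> \<le> 1 * norm (t (T w') g)" by (intro mult_right_mono nA) simp
      also have "\<dots> \<le> \<tau> * norm w'" using normT[of w'] by (simp add: norm_tensor[OF t] g)
      also have "\<dots> \<le> \<tau> * sqrt (1 - (norm p)\<^sup>2)"
        using \<tau>_pos w'1 by (intro mult_left_mono real_le_rsqrt) auto
      finally show ?thesis .
    qed
    ultimately have "max 0 (cmod m - \<tau> * sqrt (1 - (norm p)\<^sup>2)) \<le> cmod (cinner (A x) v)"
      using norm_triangle_ineq4[of "cinner (A x) v" "cinner (A x) (t (T w') g)"] by simp
    then have "(max 0 (cmod m - \<tau> * sqrt (1 - (norm p)\<^sup>2)))\<^sup>2 / \<tau>\<^sup>2 \<le> (cmod (cinner (A x) v))\<^sup>2 / \<tau>\<^sup>2"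
      by (intro divide_right_mono power_mono) auto
    with le show ?thesis by linarith
  qed
  have Tw0: "T w0 = (a * complex_of_real \<alpha> + b * \<beta>) *\<^sub>C k1 + (b * complex_of_real \<gamma>) *\<^sub>C k2"
    by (simp add: w0_def bounded_clinear_add[OF T_linear] bounded_clinear_scaleC[OF T_linear]
        Th1 Th2 scaleC_add_right scaleC_add_left scaleC_scaleC add.assoc)
  have "m1 p = cinner (A x) (t (T w0) f1)"
    unfolding Ax Tw0 by (simp add: m1_def p y1_def y2_def cinner_simps cinner_tensor[OF t] orthonormal)
  moreover have "m2 p = cinner (A x) (t (T w0) f2)"
    unfolding Ax Tw0 by (simp add: m2_def p y1_def y2_def cinner_simps cinner_tensor[OF t] orthonormal)
  ultimately have "(norm (A x - orth_proj ?M (A x)))\<^sup>2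
      \<le> (norm p)\<^sup>2 - (max 0 (cmod (m1 p) - \<tau> * sqrt (1 - (norm p)\<^sup>2)))\<^sup>2 / \<tau>\<^sup>2"
    "(norm (A x - orth_proj ?M (A x)))\<^sup>2
      \<le> (norm p)\<^sup>2 - (max 0 (cmod (m2 p) - \<tau> * sqrt (1 - (norm p)\<^sup>2)))\<^sup>2 / \<tau>\<^sup>2"
    using bound f by blast+
  then show "(norm (A x - orth_proj ?M (A x)))\<^sup>2 \<le> (norm p)\<^sup>2 - (gap p)\<^sup>2 / \<tau>\<^sup>2"
    unfolding gap_def by (cases "cmod (m1 p) \<le> cmod (m2 p)") (simp_all add: max_def)
qed

text \<open>The residual bound depends only on the pair \<open>p\<close> in the compact unit ball of
  the complex plane squared, so it attains its maximum there. It is below 1 in the interior because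
  \<open>norm p < 1\<close>, and on the sphere because \<open>gap\<close> is positive.\<close>

lemma beta_less_one: "\<exists>b<1. beta (tensor_ops t T) A \<le> b"
proof -
  define \<Phi> where "\<Phi> p = (norm p)\<^sup>2 - (gap p)\<^sup>2 / \<tau>\<^sup>2" for p
  have "continuous_on (cball 0 1) \<Phi>"
    unfolding \<Phi>_def gap_def m1_def m2_def using \<tau>_pos by (intro continuous_intros) auto
  then obtain p where p: "norm p \<le> 1" and p_max: "\<And>q. norm q \<le> 1 \<Longrightarrow> \<Phi> q \<le> \<Phi> p"
    using continuous_attains_sup[of "cball 0 1" \<Phi>] by auto
  have "\<Phi> p < 1"
  proof (cases "norm p = 1")
    case False
    then have "(norm p)\<^sup>2 < 1" using p by (simp add: power_less_one_iff)
    moreover have "0 \<le> (gap p)\<^sup>2 / \<tau>\<^sup>2" by simp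
    ultimately show ?thesis unfolding \<Phi>_def by linarith
  next
    case True
    obtain a b where ab: "p = (a, b)" by (cases p)
    have "m1 p \<noteq> 0 \<or> m2 p \<noteq> 0"
    proof (rule ccontr)
      assume "\<not> (m1 p \<noteq> 0 \<or> m2 p \<noteq> 0)"
      then have m: "m1 p = 0" "m2 p = 0" by auto
      \<comment> \<open>Once one coordinate vanishes, \<open>m1\<close> is
        \<open>- \<gamma> |b|^2\<close> or \<open>s \<alpha> |a|^2\<close>, which forces the other
        to vanish as well.\<close>
      from m(2) have "a = 0 \<or> b = 0" using \<gamma> s_nz by (simp add: m2_def ab)
      with m(1) have "a = 0 \<and> b = 0" using \<alpha> \<gamma> s_nz by (auto simp: m1_def ab)
      then show False using True by (simp add: ab norm_Pair)
    qed
    then have "0 < gap p" using True by (auto simp: gap_def less_max_iff_disj)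
    then have "0 < (gap p)\<^sup>2 / \<tau>\<^sup>2" using \<tau>_pos by simp
    then show ?thesis using True by (simp add: \<Phi>_def)
  qed
  moreover have "beta (tensor_ops t T) A \<le> sqrt (\<Phi> p)"
    unfolding beta_def
  proof (rule cSUP_least)
    show "{x :: 'l. norm x = 1} \<noteq> {}" using norm_y(1) by blast
    fix x :: 'l assume "x \<in> {x. norm x = 1}"
    then have x: "norm x = 1" by simp
    show "norm (A x - orth_proj (closure ((\<lambda>B. blinfun_apply B x) ` tensor_ops t T)) (A x)) \<le> sqrt (\<Phi> p)"
      using residual_le[OF x] p_max[OF residual_le(1)[OF x]]
      by (intro real_le_rsqrt) (simp add: \<Phi>_def)
  qed
  ultimately show ?thesis by (intro exI[of _ "sqrt (\<Phi> p)"]) simp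
qed

text \<open>An infimum of 1 would admit constants just above 1, which the distance at least 1 and
  the bound \<open>b < 1\<close> on \<open>beta\<close> exclude.\<close>

lemma kappa_tensor_ops: "kappa (tensor_ops t T) \<noteq> 1"
proof
  assume kappa: "kappa (tensor_ops t T) = 1"
  obtain b where b: "b < 1" "beta (tensor_ops t T) A \<le> b" using beta_less_one by blast
  \<comment> \<open>Chosen so that every constant in \<open>[1, C)\<close> has product with
    \<open>b\<close> below 1; for \<open>b \<le> 0\<close> the product is not positive and 2 is an
    arbitrary choice.\<close>
  define C where "C = (if b \<le> 0 then 2 else 1 / b)"
  have "1 < C" using b(1) by (simp add: C_def)
  then have "kappa (tensor_ops t T) < ereal C" using kappa by (simp add: one_ereal_def)
  then obtain C' where C': "1 \<le> C'" "C' < C" "hyperreflexive_with C' (tensor_ops t T)"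
    unfolding kappa_def Inf_less_iff by auto
  have "1 \<le> C' * beta (tensor_ops t T) A"
    using C'(3) A_in one_le_infdist unfolding hyperreflexive_with_def by fastforce
  also have "\<dots> \<le> C' * b" using C'(1) b(2) by (intro mult_left_mono) auto
  finally have "1 \<le> C' * b" .
  moreover have "C' * b < 1"
  proof (cases "b \<le> 0")
    case True
    then have "C' * b \<le> 0" using C'(1) by (simp add: mult_nonneg_nonpos)
    then show ?thesis by simp
  next
    case False
    then show ?thesis using C'(2) by (simp add: C_def field_simps)
  qed
  ultimately show False by simp
qed

end

section \<open>Reduction of the equivalence to the corner and witness cases\<close>

theorem lemma6p11:
  fixes T :: "'h::chilbert_space \<Rightarrow>\<^sub>L 'h"
    and t :: "'h \<Rightarrow> 'k::chilbert_space \<Rightarrow> 'l::chilbert_space"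
  assumes "cdim (UNIV :: 'h set) \<ge> 3"
    and "T \<in> bounded_ops" and "T \<noteq> 0"
    and "separable_space (euclidean :: 'k topology)" and "cdim (UNIV :: 'k set) = \<infinity>"
    and "hilbert_tensor t"
  shows "kappa_c t (cspan {T}) = 1 \<longleftrightarrow> crank T = 1"
proof -
  note t = \<open>hilbert_tensor t\<close> and T = \<open>T \<in> bounded_ops\<close>
  have Tl: "bounded_clinear (blinfun_apply T)" using T by (simp add: bounded_ops_iff)
  have kappa_c: "kappa_c t (cspan {T}) = kappa (tensor_ops t T)"
    unfolding kappa_c_def wot_tensor_singleton[OF t T \<open>T \<noteq> 0\<close>] ..
  obtain f1 f2 :: 'k where f: "norm f1 = 1" "norm f2 = 1" "cinner f1 f2 = 0"
    using orthonormal_pair_exists assms(5) by metis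
  obtain h where h: "T h \<noteq> 0" using \<open>T \<noteq> 0\<close> blinfun_eqI by (metis blinfun.zero_left)
  show ?thesis
  proof
    assume "crank T = 1"
    then obtain u0 where u0: "range (blinfun_apply T) \<subseteq> cspan {u0}"
      using crank_eq_1_imp_range by blast
    then have "u0 \<noteq> 0" using h by fastforce
    define u where "u = complex_of_real (inverse (norm u0)) *\<^sub>C u0"
    have u: "norm u = 1" using \<open>u0 \<noteq> 0\<close> by (simp add: u_def norm_scaleC norm_inverse)
    \<comment> \<open>Every value of \<open>T\<close> is a multiple of the unit vector
      \<open>u\<close>, with coefficient
      \<open>\<langle>T x, u\<rangle> = \<langle>x, v\<rangle>\<close>.\<close>
    define v where "v = cadj (blinfun_apply T) u"
    have Tv: "T x = cinner x v *\<^sub>C u" for x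
    proof -
      have "T x \<in> cspan {u0}" using u0 by blast
      then obtain c where "T x = c *\<^sub>C u0" by (auto simp: complex_vector.span_singleton)
      also have "u0 = complex_of_real (norm u0) *\<^sub>C u"
        using \<open>u0 \<noteq> 0\<close> by (simp add: u_def scaleC_scaleC flip: of_real_mult)
      finally obtain d where d: "T x = d *\<^sub>C u" by (auto simp: scaleC_scaleC)
      have "cinner x v = d"
        using u by (simp add: v_def cinner_cadj_right[OF Tl] d cinner_scaleC_left cinner_self)
      then show ?thesis by (simp add: d)
    qed
    have "v \<noteq> 0" using h Tv[of h] by auto
    moreover have "f1 \<noteq> 0" using f by auto
    ultimately have "hyperreflexive_with 1 (tensor_ops t T)"
      using hyperreflexive_with_1_tensor_ops[OF t Tv u] by blast
    then have "1 \<in> {ereal C | C. C \<ge> 1 \<and> hyperreflexive_with C (tensor_ops t T)}"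
      by (auto simp: one_ereal_def)
    then have "kappa (tensor_ops t T) \<le> 1" unfolding kappa_def by (rule Inf_lower)
    moreover have "1 \<le> kappa (tensor_ops t T)"
      unfolding kappa_def by (rule Inf_greatest) (auto simp: one_ereal_def)
    ultimately show "kappa_c t (cspan {T}) = 1" unfolding kappa_c by simp
  next
    assume one: "kappa_c t (cspan {T}) = 1"
    show "crank T = 1"
    proof (rule ccontr)
      assume "crank T \<noteq> 1"
      define h1 where "h1 = complex_of_real (inverse (norm h)) *\<^sub>C h"
      have "h \<noteq> 0" using h by auto
      then have h1: "norm h1 = 1" by (simp add: h1_def norm_scaleC norm_inverse)
      have Th1: "T h1 \<noteq> 0"
        using h \<open>h \<noteq> 0\<close> by (simp add: h1_def bounded_clinear_scaleC[OF Tl])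
      define \<alpha> where "\<alpha> = norm (T h1)"
      define k1 where "k1 = complex_of_real (inverse \<alpha>) *\<^sub>C T h1"
      have \<alpha>: "0 < \<alpha>" using Th1 by (simp add: \<alpha>_def)
      have k1: "norm k1 = 1" using Th1 by (simp add: k1_def norm_scaleC norm_inverse \<alpha>_def)
      have Th1k1: "T h1 = complex_of_real \<alpha> *\<^sub>C k1"
        using \<alpha> by (simp add: k1_def scaleC_scaleC flip: of_real_mult)
      \<comment> \<open>As the rank is not one, the range is not contained in the line through
        \<open>T h1\<close>.\<close>
      obtain x where x: "T x \<notin> cspan {T h1}"
        using range_imp_crank_eq_1[OF Th1] \<open>crank T \<noteq> 1\<close> by blast
      have "x \<notin> cspan {h1}"
        using x by (auto simp: complex_vector.span_singleton bounded_clinear_scaleC[OF Tl])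
      from orthogonal_decomposition[OF h1 this] obtain h2 c d where h2: "norm h2 = 1" "cinner h1 h2 = 0"
        and "x = c *\<^sub>C h1 + complex_of_real d *\<^sub>C h2" by metis
      then have "T x = c *\<^sub>C T h1 + complex_of_real d *\<^sub>C T h2"
        by (simp add: bounded_clinear_add[OF Tl] bounded_clinear_scaleC[OF Tl])
      \<comment> \<open>This is what makes the second diagonal entry \<open>\<gamma>\<close>
        positive.\<close>
      have "T h2 \<notin> cspan {k1}"
      proof
        assume "T h2 \<in> cspan {k1}"
        moreover have "k1 \<in> cspan {T h1}"
          unfolding k1_def by (simp add: complex_vector.span_scale complex_vector.span_base)
        ultimately have "T h2 \<in> cspan {T h1}"
          by (auto simp: complex_vector.span_singleton scaleC_scaleC)
        then have "T x \<in> cspan {T h1}"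
          unfolding \<open>T x = _\<close>
          by (intro complex_vector.span_add complex_vector.span_scale) (simp_all add: complex_vector.span_base)
        with x show False ..
      qed
      from orthogonal_decomposition[OF k1 this] obtain k2 \<beta> \<gamma> where "norm k2 = 1" "cinner k1 k2 = 0"
        "0 < \<gamma>" "T h2 = \<beta> *\<^sub>C k1 + complex_of_real \<gamma> *\<^sub>C k2" by metis
      then interpret tensor_witness t T h1 h2 k1 k2 f1 f2 \<alpha> \<gamma> \<beta>
        using t T h1 h2 k1 f \<alpha> Th1k1 by unfold_locales
      show False using kappa_tensor_ops one unfolding kappa_c by blast
    qed
  qed
qed

end
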